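(* Let $A\in\mathbb{R}^{n\times m}$ be $\mu$-incoherent and let $Y^{(1)},\dots,Y^{(p)}$ be samples $Y^{(j)}=AX^{(j)}$ with $X^{(j)}$ drawn independently from a distribution in class $\Gamma$, with supports $\Omega^{(j)}$. Suppose the algorithm OverlappingSVD is given the correct clustering $\mathcal C_i=\{j:i\in\Omega^{(j)}\}$, $i=1,\dots,m$. Let $\zeta=\max\left\{\frac{\mu k}{\sqrt n},\sqrt{\frac km}\right\}$. Then with high probability the algorithm outputs a dictionary $\hat A$ such that for each $i$, $\|A_i-\hat A_i\|\le\zeta$ (for the appropriate sign of $\hat A_i$), provided $k\le c\min\left(\sqrt m,\frac{\sqrt n}{\mu\log n}\right)$ and $p\ge\max\left(\frac{m^2\log m}{k^2},\frac{mn\log m\log n}{\zeta^2}\right)$.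
   Context: $A$ is $\mu$-incoherent if its columns are unit vectors and $|\langle A_p,A_q\rangle|\le\mu/\sqrt n$ for $p\ne q$. Class $\Gamma$: distributions on $k$-sparse $X\in\mathbb{R}^m$, each coordinate nonzero with probability $\Theta(k/m)$, each nonzero $X_i$ has mean $0$ and lies in $[-C,-1]\cup[1,C]$ with $C=O(1)$, and conditioned on any set of coordinates being nonzero the values are independent. $c>0$ is a sufficiently small constant. OverlappingSVD, given clusters $\mathcal C_1,\dots,\mathcal C_m$: for each $i$, compute $\hat\Sigma_i=\frac1{|\mathcal C_i|}\sum_{j\in\mathcal C_i}Y^{(j)}Y^{(j)T}$ and let $\hat A_i$ be the top (first) singular vector of $\hat\Sigma_i$ (a unit vector, determined up to sign); output $\hat A$ with columns $\hat A_i$. "With high probability" means with probability at least $1-n^{-\Delta}$ for a sufficiently large constant $\Delta$.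
   Formalization: The formal theorem also assumes bounded pairwise moments of the support, P(X_i≠0, X_j≠0) ≤ κ² P(X_i≠0)P(X_j≠0) for i≠j with c depending on the constant κ; without it the claim fails when the support is a uniformly random block of k coordinates, as clusters then coincide. *)

theory Defs
  imports "HOL-Probability.Probability"
begin

text \<open>
  The constant of the theorem is uniform in the dimensions, so the dimensions are natural numbers:
  a vector of dimension \<open>n\<close> is a function of which only the values on \<open>{..<n}\<close> matter, its Euclidean
  norm is \<open>L2_set v {..<n}\<close>, and \<open>A r i\<close> is the entry of \<open>A\<close> in row \<open>r\<close> and column \<open>i\<close>.
\<close>

definition incoherent :: "nat \<Rightarrow> nat \<Rightarrow> real \<Rightarrow> (nat \<Rightarrow> nat \<Rightarrow> real) \<Rightarrow> bool" where
  "incoherent n m \<mu> A \<longleftrightarrow>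
     (\<forall>i<m. L2_set (\<lambda>r. A r i) {..<n} = 1) \<and>
     (\<forall>i<m. \<forall>j<m. i \<noteq> j \<longrightarrow> \<bar>\<Sum>r<n. A r i * A r j\<bar> \<le> \<mu> / sqrt (real n))"

definition supp :: "nat \<Rightarrow> (nat \<Rightarrow> real) \<Rightarrow> nat set" where
  "supp m x = {i. i < m \<and> x i \<noteq> 0}"

definition nonzero_on :: "nat \<Rightarrow> (nat \<Rightarrow> real) measure \<Rightarrow> nat set \<Rightarrow> (nat \<Rightarrow> real) set" where
  "nonzero_on m D S = {x \<in> space D. S \<subseteq> supp m x}"

text \<open>
  \<open>a\<close> and \<open>b\<close> are the constants hidden in \<open>\<Theta>(k/m)\<close>. The law of \<open>X\<close> conditioned on all coordinates
  in \<open>S\<close> being nonzero is the \<open>uniform_measure\<close> of the event; under it the values on \<open>S\<close>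
  are independent and centred. For \<open>S = {i}\<close> the latter is \<open>E[X i | X i \<noteq> 0] = 0\<close>.
\<close>

definition class_Gamma ::
  "nat \<Rightarrow> nat \<Rightarrow> real \<Rightarrow> real \<Rightarrow> real \<Rightarrow> (nat \<Rightarrow> real) measure \<Rightarrow> bool" where
  "class_Gamma m k a b C D \<longleftrightarrow>
     prob_space D \<and>
     sets D = sets (\<Pi>\<^sub>M i\<in>{..<m}. (borel :: real measure)) \<and>
     (AE x in D. card (supp m x) \<le> k) \<and>
     (\<forall>i<m. a * (real k / real m) \<le> measure D (nonzero_on m D {i}) \<and>
            measure D (nonzero_on m D {i}) \<le> b * (real k / real m)) \<and>
     (AE x in D. \<forall>i\<in>supp m x. x i \<in> {-C..-1} \<union> {1..C}) \<and>
     (\<forall>S\<subseteq>{..<m}. measure D (nonzero_on m D S) > 0 \<longrightarrow>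
        prob_space.indep_vars (uniform_measure D (nonzero_on m D S))
          (\<lambda>_. borel) (\<lambda>i x. x i) S \<and>
        (\<forall>i\<in>S. (\<integral>x. x i \<partial>uniform_measure D (nonzero_on m D S)) = 0))"

text \<open>
  Bounded \<open>l\<close>-wise moments of the support. Membership in \<open>class_Gamma\<close> says nothing about how the
  events \<open>X i \<noteq> 0\<close> are correlated; without a bound for \<open>l = 2\<close> two coordinates could always be
  nonzero simultaneously, and then their clusters coincide and the columns cannot be told apart.
\<close>

definition bounded_moments ::
  "nat \<Rightarrow> nat \<Rightarrow> real \<Rightarrow> (nat \<Rightarrow> real) measure \<Rightarrow> bool" where
  "bounded_moments m l \<kappa> D \<longleftrightarrow>
     (\<forall>S\<subseteq>{..<m}. card S = l \<longrightarrow>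
        measure D (nonzero_on m D S) \<le> \<kappa> ^ l * (\<Prod>i\<in>S. measure D (nonzero_on m D {i})))"

definition mat_vec :: "nat \<Rightarrow> (nat \<Rightarrow> nat \<Rightarrow> real) \<Rightarrow> (nat \<Rightarrow> real) \<Rightarrow> nat \<Rightarrow> real" where
  "mat_vec d M x = (\<lambda>r. \<Sum>i<d. M r i * x i)"

definition singular_triple ::
  "nat \<Rightarrow> (nat \<Rightarrow> nat \<Rightarrow> real) \<Rightarrow> real \<Rightarrow> (nat \<Rightarrow> real) \<Rightarrow> (nat \<Rightarrow> real) \<Rightarrow> bool" where
  "singular_triple n M \<sigma> u v \<longleftrightarrow>
     \<sigma> \<ge> 0 \<and> L2_set u {..<n} = 1 \<and> L2_set v {..<n} = 1 \<and>
     (\<forall>r<n. mat_vec n M v r = \<sigma> * u r) \<and>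
     (\<forall>s<n. mat_vec n (\<lambda>s r. M r s) u s = \<sigma> * v s)"

definition top_singular_vector ::
  "nat \<Rightarrow> (nat \<Rightarrow> nat \<Rightarrow> real) \<Rightarrow> (nat \<Rightarrow> real) \<Rightarrow> bool" where
  "top_singular_vector n M u \<longleftrightarrow>
     (\<exists>\<sigma> v. singular_triple n M \<sigma> u v \<and>
            (\<forall>\<sigma>' u' v'. singular_triple n M \<sigma>' u' v' \<longrightarrow> \<sigma>' \<le> \<sigma>))"

definition cluster_covariance :: "(nat \<Rightarrow> nat \<Rightarrow> real) \<Rightarrow> nat set \<Rightarrow> nat \<Rightarrow> nat \<Rightarrow> real" where
  "cluster_covariance Y \<C> = (\<lambda>r s. 1 / real (card \<C>) * (\<Sum>j\<in>\<C>. Y j r * Y j s))"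

text \<open>
  Singular vectors are not unique, so the algorithm is a relation between its input (samples \<open>Y\<close>
  and clusters \<open>\<C>\<close>) and its admissible outputs \<open>Ahat\<close>.
\<close>

definition overlapping_SVD ::
  "nat \<Rightarrow> nat \<Rightarrow> (nat \<Rightarrow> nat \<Rightarrow> real) \<Rightarrow> (nat \<Rightarrow> nat set) \<Rightarrow> (nat \<Rightarrow> nat \<Rightarrow> real) \<Rightarrow> bool" where
  "overlapping_SVD n m Y \<C> Ahat \<longleftrightarrow>
     (\<forall>i<m. top_singular_vector n (cluster_covariance Y (\<C> i)) (\<lambda>r. Ahat r i))"

definition correct_clustering :: "nat \<Rightarrow> nat \<Rightarrow> (nat \<Rightarrow> nat \<Rightarrow> real) \<Rightarrow> nat \<Rightarrow> nat set" where
  "correct_clustering m p X i = {j. j < p \<and> i \<in> supp m (X j)}"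

definition zeta :: "nat \<Rightarrow> nat \<Rightarrow> nat \<Rightarrow> real \<Rightarrow> real" where
  "zeta n m k \<mu> = max (\<mu> * real k / sqrt (real n)) (sqrt (real k / real m))"

text \<open>
  Inner probability: for measurable \<open>P\<close> this is just \<open>measure M {\<omega> \<in> space M. P \<omega>} \<ge> q\<close>, but it does
  not read \<open>measure\<close> at a set that is not known to be measurable.
\<close>

definition holds_with_prob :: "'a measure \<Rightarrow> real \<Rightarrow> ('a \<Rightarrow> bool) \<Rightarrow> bool" where
  "holds_with_prob M q P \<longleftrightarrow> (\<exists>E\<in>sets M. measure M E \<ge> q \<and> (\<forall>\<omega>\<in>E. P \<omega>))"

end

theory Submission imports Defs begin

text \<open>
  Fix a column \<open>e = A\<^sub>i\<close> and write a sample of its cluster as \<open>Y = X\<^sub>i e + Y'\<close>. Conditional independence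
  and centring make \<open>E[1(X\<^sub>i \<noteq> 0) Y' Y\<^sup>T]\<close> a combination of the matrices \<open>A\<^sub>l A\<^sub>l\<^sup>T\<close>, \<open>l \<noteq> i\<close>, whose
  weights relative to \<open>P(X\<^sub>i \<noteq> 0)\<close> are \<open>O(k/m)\<close>. By incoherence it is therefore small as a quadratic form,
  and applied to \<open>e\<close> it has norm \<open>o(\<mu>k/\<surd>n)\<close>; this second, better bound is what yields the error \<open>\<zeta>\<close>
  with constant 1. Since \<open>e\<close> has Rayleigh quotient at least 1/2, the top eigenvector is within a constant
  multiple of the part of \<open>\<Sigma> e\<close> orthogonal to \<open>e\<close>.

  Two concentration bounds suffice: the coordinates of \<open>\<Sigma> e\<close> are controlled by a Bernstein inequality, and
  the quadratic form by a Chernoff bound over a grid of \<open>n\<^sup>3\<^sup>n\<close> points, which the factor \<open>n log m log n\<close> in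
  the sample size pays for. Comparing the trace with the Frobenius norm of \<open>A A\<^sup>T\<close> gives \<open>n \<ge> 1/(5c\<^sup>2)\<close>, so
  both logarithms exceed any prescribed constant.
\<close>

section \<open>Top singular vectors of positive semidefinite matrices\<close>

text \<open>The two blocks of the covariance are needed at different accuracy. On the orthogonal
  complement of the column a constant bound suffices, because it only has to leave a spectral gap;
  the off-diagonal block alone has to be of order \<zeta>. This decides how the sample size is
  spent. For a grid point the threshold is constant, so the exponent keeps the full factor
  \<open>n\<close> and outweighs the logarithm of the grid size. For the coordinates the threshold
  is of order \<zeta> divided by the root of \<open>n\<close>, which consumes both \<open>n\<close>
  and the inverse square of \<zeta>, but only \<open>2 * n\<close> events have to be excluded.

  The obstacle is that neither the sample size nor the failure probability carries an adjustable
  constant. All constants, including \<open>a\<close> and \<open>C\<close>, must be absorbed by the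
  product of two logarithms, and for that each logarithm has to be large by itself. Hence the
  dimensions are bounded from below through the choice of \<open>c\<close>, and the target \<zeta>
  with constant 1 is met because the systematic part of the off-diagonal error has a further factor
  that tends to 0 with \<open>c\<close>.\<close>

definition dotp :: "nat \<Rightarrow> (nat \<Rightarrow> real) \<Rightarrow> (nat \<Rightarrow> real) \<Rightarrow> real" where
  "dotp n u v = (\<Sum>r<n. u r * v r)"

lemma dotp_commute: "dotp n u v = dotp n v u"
  by (simp add: dotp_def mult.commute)

lemma dotp_add_left: "dotp n (\<lambda>r. u r + v r) w = dotp n u w + dotp n v w"
  by (simp add: dotp_def algebra_simps sum.distrib)

lemma dotp_diff_left: "dotp n (\<lambda>r. u r - v r) w = dotp n u w - dotp n v w"
  by (simp add: dotp_def algebra_simps sum_subtractf)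

lemma dotp_scale_left: "dotp n (\<lambda>r. c * u r) w = c * dotp n u w"
  by (simp add: dotp_def sum_distrib_left algebra_simps)

lemma dotp_add_right: "dotp n w (\<lambda>r. u r + v r) = dotp n w u + dotp n w v"
  by (simp add: dotp_def algebra_simps sum.distrib)

lemma dotp_diff_right: "dotp n w (\<lambda>r. u r - v r) = dotp n w u - dotp n w v"
  by (simp add: dotp_def algebra_simps sum_subtractf)

lemma dotp_scale_right: "dotp n w (\<lambda>r. c * u r) = c * dotp n w u"
  by (simp add: dotp_def sum_distrib_left algebra_simps)

lemmas dotp_linear =
  dotp_add_left dotp_diff_left dotp_scale_left dotp_add_right dotp_diff_right dotp_scale_right

lemma dotp_sum_left: "dotp n (\<lambda>r. \<Sum>i\<in>I. f i r) w = (\<Sum>i\<in>I. dotp n (f i) w)"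
  unfolding dotp_def sum_distrib_right by (rule sum.swap)

lemma dotp_sum_right: "dotp n w (\<lambda>r. \<Sum>i\<in>I. f i r) = (\<Sum>i\<in>I. dotp n w (f i))"
  unfolding dotp_def sum_distrib_left by (rule sum.swap)

lemma dotp_cong: "(\<And>r. r < n \<Longrightarrow> u r = u' r) \<Longrightarrow> (\<And>r. r < n \<Longrightarrow> v r = v' r) \<Longrightarrow> dotp n u v = dotp n u' v'"
  by (simp add: dotp_def)

lemma dotp_self_nonneg [simp]: "dotp n u u \<ge> 0"
  by (simp add: dotp_def sum_nonneg)

lemma dotp_self_eq_0D: "dotp n u u = 0 \<Longrightarrow> r < n \<Longrightarrow> u r = 0"
  by (simp add: dotp_def sum_nonneg_eq_0_iff)

lemma L2_set_dotp: "L2_set u {..<n} = sqrt (dotp n u u)"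
  by (simp add: L2_set_def dotp_def power2_eq_square)

lemma dotp_Cauchy_Schwarz: "(dotp n u v)\<^sup>2 \<le> dotp n u u * dotp n v v"
  using Cauchy_Schwarz_ineq_sum[of u v "{..<n}"] by (simp add: dotp_def power2_eq_square)

lemma dotp_abs_le: "\<bar>dotp n u v\<bar> \<le> sqrt (dotp n u u) * sqrt (dotp n v v)"
  using real_sqrt_le_mono[OF dotp_Cauchy_Schwarz[of n u v]] by (simp add: real_sqrt_mult)

lemma component_sq_le_dotp: "r < n \<Longrightarrow> (u r)\<^sup>2 \<le> dotp n u u"
  unfolding dotp_def by (simp add: power2_eq_square member_le_sum[of r "{..<n}" "\<lambda>r. u r * u r"])

section \<open>Matrices acting on vectors; eigenvectors as maximisers of the quadratic form\<close>

lemma mat_vec_add: "mat_vec n Q (\<lambda>r. u r + v r) = (\<lambda>r. mat_vec n Q u r + mat_vec n Q v r)"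
  by (simp add: mat_vec_def algebra_simps sum.distrib)

lemma mat_vec_diff: "mat_vec n Q (\<lambda>r. u r - v r) = (\<lambda>r. mat_vec n Q u r - mat_vec n Q v r)"
  by (simp add: mat_vec_def algebra_simps sum_subtractf)

lemma mat_vec_scale: "mat_vec n Q (\<lambda>r. c * u r) = (\<lambda>r. c * mat_vec n Q u r)"
  by (simp add: mat_vec_def algebra_simps sum_distrib_left)

lemma mat_vec_cong: "(\<And>r. r < n \<Longrightarrow> u r = v r) \<Longrightarrow> mat_vec n Q u = mat_vec n Q v"
  by (simp add: mat_vec_def fun_eq_iff)

lemma dotp_mat_vec_symmetric:
  assumes "\<And>r s. Q r s = Q s r"
  shows "dotp n u (mat_vec n Q v) = dotp n (mat_vec n Q u) v"
proof -
  have "dotp n u (mat_vec n Q v) = (\<Sum>r<n. \<Sum>s<n. u r * Q r s * v s)"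
    by (simp add: dotp_def mat_vec_def sum_distrib_left mult.assoc)
  also have "\<dots> = (\<Sum>s<n. \<Sum>r<n. u r * Q r s * v s)"
    by (rule sum.swap)
  also have "\<dots> = dotp n (mat_vec n Q u) v"
    unfolding dotp_def mat_vec_def sum_distrib_right
    by (intro sum.cong refl) (metis assms mult.commute)
  finally show ?thesis .
qed

text \<open>Fixing the entries from \<open>n\<close> on to 0 embeds the sphere into a product of
  intervals and singletons, which is compact by Tychonoff; the norm condition depends on finitely
  many coordinates and is closed in the product topology.\<close>

lemma compact_unit_sphere_fun:
  "compact {x :: nat \<Rightarrow> real. (\<forall>r\<ge>n. x r = 0) \<and> dotp n x x = 1}" (is "compact ?S")
proof -
  define K :: "(nat \<Rightarrow> real) set" where "K = (\<Pi>\<^sub>E r\<in>UNIV. if r < n then {-1..1} else {0})"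
  have "compactin (product_topology (\<lambda>_::nat. euclidean :: real topology) UNIV) K"
    unfolding K_def compactin_PiE by (auto simp: compactin_euclidean_iff)
  then have cK: "compact K"
    by (simp add: euclidean_product_topology compactin_euclidean_iff)
  have clos: "closed {x :: nat \<Rightarrow> real. dotp n x x = 1}"
    unfolding dotp_def by (intro closed_Collect_eq continuous_intros) auto
  have "?S = K \<inter> {x. dotp n x x = 1}"
  proof (intro set_eqI iffI)
    fix x assume x: "x \<in> ?S"
    have "x r \<in> {-1..1}" if "r < n" for r
    proof -
      have "(x r)\<^sup>2 \<le> 1" using component_sq_le_dotp[OF that, of x] x by simp
      then show ?thesis by (simp add: abs_square_le_1 abs_le_iff)
    qed
    then show "x \<in> K \<inter> {x. dotp n x x = 1}" using x by (auto simp: K_def PiE_iff)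
  next
    fix x assume x: "x \<in> K \<inter> {x. dotp n x x = 1}"
    have "x r = 0" if "r \<ge> n" for r
    proof -
      have "x r \<in> (if r < n then {-1..1} else {0})" using x by (auto simp: K_def PiE_iff)
      then show ?thesis using that by simp
    qed
    then show "x \<in> ?S" using x by simp
  qed
  then show ?thesis using compact_Int_closed[OF cK clos] by simp
qed

text \<open>A maximiser of the quadratic form on the sphere is an eigenvector, because
  the first variation of \<open>y \<mapsto> \<rho>|y|\<^sup>2 - \<langle>y, Q y\<rangle> \<ge> 0\<close> vanishes at its zero.\<close>

lemma symmetric_top_eigenvector:
  assumes sym: "\<And>r s. Q r s = Q s r" and n: "n > 0"
  obtains x \<rho> where "dotp n x x = 1" "\<And>r. r < n \<Longrightarrow> mat_vec n Q x r = \<rho> * x r"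
    "\<And>y. dotp n y (mat_vec n Q y) \<le> \<rho> * dotp n y y"
proof -
  define S where "S = {x :: nat \<Rightarrow> real. (\<forall>r\<ge>n. x r = 0) \<and> dotp n x x = 1}"
  define \<phi> where "\<phi> = (\<lambda>y. dotp n y (mat_vec n Q y))"
  have "(\<lambda>r. if r = 0 then 1 else 0) \<in> S"
    using n by (auto simp: S_def dotp_def if_distrib sum.delta cong: if_cong)
  then have ne: "S \<noteq> {}" by blast
  have "continuous_on S \<phi>"
    unfolding \<phi>_def dotp_def mat_vec_def
    by (intro continuous_intros continuous_on_subset[OF continuous_on_product_coordinates]) auto
  then obtain x where x: "x \<in> S" and max: "\<And>y. y \<in> S \<Longrightarrow> \<phi> y \<le> \<phi> x"
    using continuous_attains_sup[OF compact_unit_sphere_fun[of n, folded S_def] ne] by blast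
  define \<rho> where "\<rho> = \<phi> x"
  have xx: "dotp n x x = 1" using x by (simp add: S_def)
  have bound: "\<phi> y \<le> \<rho> * dotp n y y" for y
  proof (cases "dotp n y y = 0")
    case True
    then have "\<phi> y = 0" unfolding \<phi>_def dotp_def[of n y "mat_vec n Q y"]
      using dotp_self_eq_0D[OF True] by simp
    then show ?thesis using True by simp
  next
    case False
    define d where "d = sqrt (dotp n y y)"
    have d: "d > 0" "d * d = dotp n y y" using False by (auto simp: d_def less_le)
    \<comment> \<open>The entries beyond \<open>n\<close> are cut off only because membership in
      \<open>S\<close> demands it; neither form sees them.\<close>
    define z where "z = (\<lambda>r. if r < n then (1 / d) * y r else 0)"
    have 1: "dotp n z z = dotp n (\<lambda>r. (1 / d) * y r) (\<lambda>r. (1 / d) * y r)"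
      by (rule dotp_cong) (auto simp: z_def)
    have "dotp n z z = 1" unfolding 1 dotp_linear d(2)[symmetric] using d(1) by simp
    then have "z \<in> S" by (auto simp: S_def z_def)
    from max[OF this] have "\<phi> z \<le> \<rho>" by (simp add: \<rho>_def)
    moreover have "\<phi> z = dotp n (\<lambda>r. (1 / d) * y r) (mat_vec n Q (\<lambda>r. (1 / d) * y r))"
      unfolding \<phi>_def
      by (rule dotp_cong) (auto simp: z_def intro!: fun_cong[OF mat_vec_cong])
    then have "\<phi> z = \<phi> y / (d * d)"
      unfolding mat_vec_scale dotp_linear by (simp add: \<phi>_def)
    ultimately have "\<phi> y / (d * d) \<le> \<rho>" by simp
    moreover have "0 < d * d" using d(1) by simp
    ultimately show ?thesis unfolding d(2)[symmetric] by (simp only: pos_divide_le_eq)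
  qed
  define z where "z = (\<lambda>r. mat_vec n Q x r - \<rho> * x r)"
  have first_var: "dotp n z z = 0"
  proof (rule ccontr)
    assume "dotp n z z \<noteq> 0"
    then have zz: "dotp n z z > 0" by (simp add: less_le)
    define R where "R = \<rho> * dotp n z z - \<phi> z"
    have R: "R \<ge> 0" using bound[of z] by (simp add: R_def)
    \<comment> \<open>Moving from \<open>x\<close> to \<open>x + t z\<close> changes the nonnegative
      difference by \<open>- 2 * t * dotp n z z + t * t * R\<close>, which is negative for every
      positive \<open>t\<close> with \<open>t * R < 2 * dotp n z z\<close>. The added 1 covers
      \<open>R = 0\<close>.\<close>
    define t where "t = dotp n z z / (R + 1)"
    have "\<phi> (\<lambda>r. x r + t * z r) = \<phi> x + 2 * t * dotp n z (mat_vec n Q x) + t * t * \<phi> z"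
      unfolding \<phi>_def mat_vec_add mat_vec_scale dotp_linear
      using dotp_mat_vec_symmetric[of Q n x z, OF sym] dotp_commute[of n z "mat_vec n Q x"]
      by (simp add: algebra_simps)
    moreover have "dotp n (\<lambda>r. x r + t * z r) (\<lambda>r. x r + t * z r)
        = 1 + 2 * t * dotp n z x + t * t * dotp n z z"
      unfolding dotp_linear xx by (simp add: algebra_simps dotp_commute[of n x z])
    moreover have "dotp n z (mat_vec n Q x) = dotp n z z + \<rho> * dotp n z x"
      by (subst (3) z_def) (simp add: dotp_linear)
    ultimately have "2 * t * dotp n z z \<le> t * t * R"
      using bound[of "\<lambda>r. x r + t * z r"] by (simp add: R_def \<rho>_def algebra_simps)
    moreover have t: "t > 0" using zz R by (simp add: t_def)
    ultimately have "2 * dotp n z z \<le> t * R" by (simp add: mult.assoc)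
    moreover have "t * R \<le> dotp n z z"
      using R zz by (simp add: t_def field_simps)
    ultimately show False using zz by simp
  qed
  show ?thesis
  proof (rule that)
    show "dotp n x x = 1" by fact
    show "mat_vec n Q x r = \<rho> * x r" if "r < n" for r
      using dotp_self_eq_0D[OF first_var that] by (simp add: z_def)
    show "dotp n y (mat_vec n Q y) \<le> \<rho> * dotp n y y" for y
      using bound[of y] by (simp add: \<phi>_def)
  qed
qed

text \<open>For symmetric \<open>Q\<close> a singular triple satisfies
  \<open>Q v = \<sigma> u\<close> and \<open>Q u = \<sigma> v\<close>, so \<open>u - v\<close> is an
  eigenvector direction for the value \<open>- \<sigma>\<close>. Semidefiniteness and
  \<open>\<sigma> > 0\<close> force \<open>u = v\<close> on the first \<open>n\<close> entries. The
  Rayleigh maximiser is itself a singular vector, which bounds \<sigma> from below by the form at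
  \<open>e\<close>.\<close>

lemma top_singular_vector_psd:
  assumes sym: "\<And>r s. Q r s = Q s r" and n: "n > 0"
    and psd: "\<And>y. dotp n y (mat_vec n Q y) \<ge> 0"
    and e: "dotp n e e = 1" "dotp n e (mat_vec n Q e) > 0"
    and top: "top_singular_vector n Q u"
  obtains \<sigma> where "\<sigma> \<ge> dotp n e (mat_vec n Q e)" "dotp n u u = 1"
    "\<And>r. r < n \<Longrightarrow> mat_vec n Q u r = \<sigma> * u r"
proof -
  from top obtain \<sigma> v where t: "singular_triple n Q \<sigma> u v"
    and max: "\<And>\<sigma>' u' v'. singular_triple n Q \<sigma>' u' v' \<Longrightarrow> \<sigma>' \<le> \<sigma>"
    unfolding top_singular_vector_def by blast
  have symQ: "(\<lambda>s r. Q r s) = Q" using sym by (intro ext) simp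
  obtain x \<rho> where x: "dotp n x x = 1" "\<And>r. r < n \<Longrightarrow> mat_vec n Q x r = \<rho> * x r"
    "\<And>y. dotp n y (mat_vec n Q y) \<le> \<rho> * dotp n y y"
    using symmetric_top_eigenvector[of Q n] sym n by blast
  have \<rho>: "\<rho> \<ge> dotp n e (mat_vec n Q e)" using x(3)[of e] e by simp
  have "singular_triple n Q \<rho> x x"
    using x \<rho> e by (simp add: singular_triple_def L2_set_dotp symQ)
  then have s: "\<sigma> \<ge> dotp n e (mat_vec n Q e)" using max \<rho> by force
  have uv: "dotp n u u = 1" "\<And>r. r < n \<Longrightarrow> mat_vec n Q v r = \<sigma> * u r"
    "\<And>r. r < n \<Longrightarrow> mat_vec n Q u r = \<sigma> * v r"
    using t by (auto simp: singular_triple_def L2_set_dotp symQ)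
  let ?d = "\<lambda>r. u r - v r"
  have "dotp n ?d (mat_vec n Q ?d) = dotp n ?d (\<lambda>r. (- \<sigma>) * ?d r)"
    unfolding mat_vec_diff by (rule dotp_cong) (auto simp: uv algebra_simps)
  then have "\<sigma> * dotp n ?d ?d \<le> 0"
    using psd[of ?d] unfolding dotp_scale_right by simp
  then have "dotp n ?d ?d = 0"
    using s e dotp_self_nonneg[of n ?d] by (smt (verit) mult_pos_pos)
  then have "u r = v r" if "r < n" for r
    using dotp_self_eq_0D[OF _ that] by force
  then show ?thesis using that s uv by force
qed

text \<open>Split \<open>u\<close> into \<open>\<alpha> e + w\<close> with \<open>w\<close>
  orthogonal to \<open>e\<close> and test the eigenvalue equation against \<open>w\<close>: this
  gives \<open>(\<sigma> - h) |w|^2 \<le> g |w|\<close>, hence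
  \<open>|w| \<le> g / \<gamma>\<close>. Only \<open>g\<close> affects the size of the error;
  \<open>h\<close> enters through the gap. The factor \<open>sqrt 2\<close> is the price of passing
  from \<open>|w|\<close>, a sine, to the distance of the unit vectors.\<close>

lemma top_singular_vector_perturbation:
  assumes sym: "\<And>r s. Q r s = Q s r" and n: "n > 0"
    and psd: "\<And>y. dotp n y (mat_vec n Q y) \<ge> 0"
    and e: "dotp n e e = 1"
    and g: "\<And>w. dotp n e w = 0 \<Longrightarrow> \<bar>dotp n w (mat_vec n Q e)\<bar> \<le> g * sqrt (dotp n w w)"
    and h: "\<And>w. dotp n e w = 0 \<Longrightarrow> dotp n w (mat_vec n Q w) \<le> h * dotp n w w"
    and gap: "dotp n e (mat_vec n Q e) \<ge> h + \<gamma>" "\<gamma> > 0" "h \<ge> 0" and g0: "g \<ge> 0"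
    and top: "top_singular_vector n Q u"
  shows "\<exists>s\<in>{1, -1}. L2_set (\<lambda>r. e r - s * u r) {..<n} \<le> sqrt 2 * (g / \<gamma>)"
proof -
  have "dotp n e (mat_vec n Q e) > 0" using gap by linarith
  then obtain \<sigma> where \<sigma>: "\<sigma> \<ge> dotp n e (mat_vec n Q e)" and uu: "dotp n u u = 1"
    and eig: "\<And>r. r < n \<Longrightarrow> mat_vec n Q u r = \<sigma> * u r"
    using top_singular_vector_psd[of Q n e u] assms by blast
  define \<alpha> where "\<alpha> = dotp n e u"
  define w where "w = (\<lambda>r. u r - \<alpha> * e r)"
  define d where "d = sqrt (dotp n w w)"
  have d: "d \<ge> 0" "d * d = dotp n w w" by (auto simp: d_def)
  have ew: "dotp n e w = 0"
    unfolding w_def dotp_linear e by (simp add: \<alpha>_def)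
  have wu: "dotp n w u = dotp n w w"
  proof -
    have "dotp n w w = dotp n w u - \<alpha> * dotp n w e"
      by (subst (2) w_def) (simp add: dotp_linear)
    then show ?thesis using ew by (simp add: dotp_commute)
  qed
  have ww: "dotp n w w = 1 - \<alpha> * \<alpha>"
    unfolding w_def dotp_linear e uu by (simp add: \<alpha>_def dotp_commute[of n u e])
  have \<alpha>1: "\<bar>\<alpha>\<bar> \<le> 1"
    using ww dotp_self_nonneg[of n w] by (smt (verit) mult_less_cancel_left1 mult_minus_left mult_minus_right)
  have "\<sigma> * dotp n w w = dotp n w (mat_vec n Q u)"
    using wu dotp_cong[of n w w "mat_vec n Q u" "\<lambda>r. \<sigma> * u r"] eig by (simp add: dotp_linear)
  also have "mat_vec n Q u = (\<lambda>r. mat_vec n Q w r + \<alpha> * mat_vec n Q e r)"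
    by (simp add: w_def mat_vec_diff mat_vec_scale)
  also have "dotp n w \<dots> = dotp n w (mat_vec n Q w) + \<alpha> * dotp n w (mat_vec n Q e)"
    by (simp add: dotp_linear)
  also have "\<dots> \<le> h * dotp n w w + g * d"
  proof -
    have "\<alpha> * dotp n w (mat_vec n Q e) \<le> \<bar>\<alpha>\<bar> * \<bar>dotp n w (mat_vec n Q e)\<bar>"
      by (metis abs_ge_self abs_mult)
    also have "\<dots> \<le> \<bar>dotp n w (mat_vec n Q e)\<bar>"
      using \<alpha>1 by (simp add: mult_left_le_one_le)
    finally show ?thesis using h[OF ew] g[OF ew] by (simp add: d_def)
  qed
  finally have "(\<sigma> - h) * (d * d) \<le> g * d" using d by (simp add: algebra_simps)
  moreover have "\<gamma> * (d * d) \<le> (\<sigma> - h) * (d * d)"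
    using \<sigma> gap by (intro mult_right_mono) auto
  ultimately have le: "d * (\<gamma> * d) \<le> d * g" by (simp add: algebra_simps)
  have dg: "d \<le> g / \<gamma>"
  proof (cases "d = 0")
    case True then show ?thesis using g0 gap by simp
  next
    case False
    then show ?thesis using le d gap by (simp add: pos_le_divide_eq mult.commute)
  qed
  \<comment> \<open>The sign that aligns \<open>u\<close> with \<open>e\<close>; the squared
    distance is then \<open>2 - 2 * \<bar>\<alpha>\<bar>\<close>, at most
    \<open>2 * (1 - \<alpha> * \<alpha>)\<close> because
    \<open>\<bar>\<alpha>\<bar> \<le> 1\<close>.\<close>
  define s :: real where "s = (if \<alpha> \<ge> 0 then 1 else -1)"
  have s: "s \<in> {1, -1}" "s * s = 1" "s * \<alpha> = \<bar>\<alpha>\<bar>" by (auto simp: s_def)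
  have "dotp n (\<lambda>r. e r - s * u r) (\<lambda>r. e r - s * u r) = 2 - 2 * \<bar>\<alpha>\<bar>"
    unfolding dotp_linear e uu using s by (simp add: algebra_simps \<alpha>_def dotp_commute[of n u e])
  also have "\<dots> \<le> 2 * (d * d)"
  proof -
    have "\<bar>\<alpha>\<bar> * \<bar>\<alpha>\<bar> \<le> \<bar>\<alpha>\<bar>" using \<alpha>1 by (rule mult_left_le) simp
    then show ?thesis using ww d by simp
  qed
  finally have "L2_set (\<lambda>r. e r - s * u r) {..<n} \<le> sqrt (2 * (d * d))"
    unfolding L2_set_dotp by (rule real_sqrt_le_mono)
  also have "\<dots> = sqrt 2 * d" using d(1) unfolding real_sqrt_mult by simp
  also have "\<dots> \<le> sqrt 2 * (g / \<gamma>)" using dg by (rule mult_left_mono) simp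
  finally show ?thesis using s by blast
qed

section \<open>Incoherent matrices\<close>

definition col :: "(nat \<Rightarrow> nat \<Rightarrow> real) \<Rightarrow> nat \<Rightarrow> nat \<Rightarrow> real" where
  "col A i = (\<lambda>r. A r i)"

lemma incoherent_col_unit: "incoherent n m \<mu> A \<Longrightarrow> i < m \<Longrightarrow> dotp n (col A i) (col A i) = 1"
  unfolding incoherent_def col_def L2_set_dotp by (metis real_sqrt_eq_1_iff)

lemma incoherent_col_dotp:
  "incoherent n m \<mu> A \<Longrightarrow> i < m \<Longrightarrow> j < m \<Longrightarrow> i \<noteq> j \<Longrightarrow> \<bar>dotp n (col A i) (col A j)\<bar> \<le> \<mu> / sqrt (real n)"
  by (simp add: incoherent_def col_def dotp_def)

text \<open>The Gram matrix of the columns is the identity up to entries of size at most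
  \<open>\<mu> / sqrt n\<close>, whose contribution is at most that size times the square of the
  1-norm of \<open>z\<close>. Keeping \<open>card T\<close> explicit allows two uses:
  \<open>T\<close> a support, where the factor is at most 2, and \<open>T\<close> all other
  columns.\<close>

lemma incoherent_synthesis_bound:
  assumes inc: "incoherent n m \<mu> A" and \<mu>: "\<mu> \<ge> 0" and T: "T \<subseteq> {..<m}"
  shows "dotp n (\<lambda>r. \<Sum>l\<in>T. z l * col A l r) (\<lambda>r. \<Sum>l\<in>T. z l * col A l r)
     \<le> (1 + real (card T) * (\<mu> / sqrt (real n))) * (\<Sum>l\<in>T. (z l)\<^sup>2)"
proof -
  have fin: "finite T" using T finite_subset by blast
  let ?e = "\<mu> / sqrt (real n)"
  have e0: "?e \<ge> 0" using \<mu> by simp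
  have "dotp n (\<lambda>r. \<Sum>l\<in>T. z l * col A l r) (\<lambda>r. \<Sum>l\<in>T. z l * col A l r)
      = (\<Sum>l\<in>T. \<Sum>j\<in>T. z l * z j * dotp n (col A l) (col A j))"
    unfolding dotp_sum_left dotp_sum_right dotp_linear by (simp add: mult_ac)
  \<comment> \<open>The incoherence term is kept on the diagonal as well, so that the double sum
    becomes a full square.\<close>
  also have "\<dots> \<le> (\<Sum>l\<in>T. \<Sum>j\<in>T. (if l = j then (z l)\<^sup>2 else 0) + ?e * (\<bar>z l\<bar> * \<bar>z j\<bar>))"
  proof (intro sum_mono)
    fix l j assume lj: "l \<in> T" "j \<in> T"
    show "z l * z j * dotp n (col A l) (col A j)
        \<le> (if l = j then (z l)\<^sup>2 else 0) + ?e * (\<bar>z l\<bar> * \<bar>z j\<bar>)"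
    proof (cases "l = j")
      case True
      then show ?thesis
        using incoherent_col_unit[OF inc, of j] lj T \<mu> by (auto simp: power2_eq_square subset_iff)
    next
      case False
      have "z l * z j * dotp n (col A l) (col A j) \<le> \<bar>z l * z j * dotp n (col A l) (col A j)\<bar>"
        by simp
      also have "\<dots> = (\<bar>z l\<bar> * \<bar>z j\<bar>) * \<bar>dotp n (col A l) (col A j)\<bar>"
        by (simp add: abs_mult)
      also have "\<dots> \<le> (\<bar>z l\<bar> * \<bar>z j\<bar>) * ?e"
        using incoherent_col_dotp[OF inc, of l j] False lj T by (intro mult_left_mono) auto
      finally show ?thesis using False by (simp add: mult.commute)
    qed
  qed
  also have "\<dots> = (\<Sum>l\<in>T. (z l)\<^sup>2) + ?e * (\<Sum>l\<in>T. \<bar>z l\<bar>)\<^sup>2"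
    unfolding power2_eq_square sum_product using fin
    by (simp add: sum.distrib sum.delta sum_distrib_left del: times_divide_eq_left)
  also have "\<dots> \<le> (\<Sum>l\<in>T. (z l)\<^sup>2) + ?e * (real (card T) * (\<Sum>l\<in>T. (z l)\<^sup>2))"
    using Cauchy_Schwarz_ineq_sum[of "\<lambda>_. 1" "\<lambda>l. \<bar>z l\<bar>" T] e0
    by (intro add_left_mono mult_left_mono) auto
  finally show ?thesis by (simp add: algebra_simps)
qed

text \<open>A matrix and its transpose have the same norm: the left side is the inner product of
  \<open>x\<close> with its own synthesis \<open>v\<close>, so Cauchy-Schwarz and the synthesis
  bound yield an inequality in which one factor of the left side cancels.\<close>

lemma incoherent_analysis_bound:
  assumes inc: "incoherent n m \<mu> A" and \<mu>: "\<mu> \<ge> 0" and T: "T \<subseteq> {..<m}"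
  shows "(\<Sum>l\<in>T. (dotp n x (col A l))\<^sup>2) \<le> (1 + real (card T) * (\<mu> / sqrt (real n))) * dotp n x x"
proof -
  define z where "z = (\<lambda>l. dotp n x (col A l))"
  define Z where "Z = (\<Sum>l\<in>T. (z l)\<^sup>2)"
  define v where "v = (\<lambda>r. \<Sum>l\<in>T. z l * col A l r)"
  let ?K = "1 + real (card T) * (\<mu> / sqrt (real n))"
  have K: "?K \<ge> 0" using \<mu> by simp
  have Z0: "Z \<ge> 0" by (simp add: Z_def sum_nonneg)
  have "Z = dotp n x v"
    unfolding v_def dotp_sum_right dotp_linear Z_def z_def power2_eq_square ..
  then have "Z\<^sup>2 \<le> dotp n x x * dotp n v v" using dotp_Cauchy_Schwarz by simp
  also have "\<dots> \<le> dotp n x x * (?K * Z)"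
    unfolding v_def Z_def by (intro mult_left_mono incoherent_synthesis_bound[OF assms]) simp
  finally have "Z * Z \<le> (?K * dotp n x x) * Z" by (simp add: power2_eq_square mult_ac)
  then have "Z \<le> ?K * dotp n x x"
    using Z0 K by (cases "Z = 0") (auto simp: mult_nonneg_nonneg)
  then show ?thesis by (simp add: Z_def z_def)
qed

text \<open>Cauchy--Schwarz for the trace of \<open>A A\<^sup>T\<close>, which has rank at most \<open>n\<close>.\<close>

lemma incoherent_dimension_bound:
  assumes inc: "incoherent n m \<mu> A" and m: "m > 0" and n: "n > 0"
  shows "1 / real n \<le> 1 / real m + \<mu>\<^sup>2 / real n"
proof -
  let ?G = "\<lambda>r s. \<Sum>i<m. A r i * A s i"
  have "real m = (\<Sum>i<m. dotp n (col A i) (col A i))"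
    using incoherent_col_unit[OF inc] by simp
  also have "\<dots> = (\<Sum>r<n. ?G r r)"
    unfolding dotp_def col_def by (rule sum.swap)
  finally have tr: "real m = (\<Sum>r<n. ?G r r)" .
  have "(real m)\<^sup>2 \<le> real n * (\<Sum>r<n. (?G r r)\<^sup>2)"
    unfolding tr using Cauchy_Schwarz_ineq_sum[of "\<lambda>_. 1" "\<lambda>r. ?G r r" "{..<n}"] by simp
  also have "(\<Sum>r<n. (?G r r)\<^sup>2) \<le> (\<Sum>r<n. \<Sum>s<n. (?G r s)\<^sup>2)"
    by (intro sum_mono member_le_sum[of _ "{..<n}" "\<lambda>s. (?G _ s)\<^sup>2"]) auto
  also have "\<dots> = (\<Sum>r<n. \<Sum>s<n. \<Sum>i<m. \<Sum>j<m. (A r i * A r j) * (A s i * A s j))"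
    by (simp add: power2_eq_square sum_product mult_ac)
  \<comment> \<open>Exchanging the index pairs identifies the Frobenius norms of the two Gram
    matrices; the \<open>m\<close> by \<open>m\<close> one is controlled by incoherence.\<close>
  also have "\<dots> = (\<Sum>i<m. \<Sum>j<m. \<Sum>r<n. \<Sum>s<n. (A r i * A r j) * (A s i * A s j))"
  proof -
    have "(\<Sum>r<n. \<Sum>s<n. \<Sum>i<m. \<Sum>j<m. (A r i * A r j) * (A s i * A s j))
       = (\<Sum>(r,s)\<in>{..<n}\<times>{..<n}. \<Sum>(i,j)\<in>{..<m}\<times>{..<m}. (A r i * A r j) * (A s i * A s j))"
      unfolding sum.cartesian_product[symmetric] by simp
    also have "\<dots> = (\<Sum>(i,j)\<in>{..<m}\<times>{..<m}. \<Sum>(r,s)\<in>{..<n}\<times>{..<n}. (A r i * A r j) * (A s i * A s j))"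
      unfolding case_prod_beta by (rule sum.swap)
    finally show ?thesis unfolding sum.cartesian_product[symmetric] by simp
  qed
  also have "\<dots> = (\<Sum>i<m. \<Sum>j<m. (dotp n (col A i) (col A j))\<^sup>2)"
    by (simp add: dotp_def col_def power2_eq_square sum_product)
  also have "\<dots> \<le> (\<Sum>i<m. \<Sum>j<m. (if i = j then 1 else 0) + \<mu>\<^sup>2 / real n)"
  proof (intro sum_mono)
    fix i j assume ij: "i \<in> {..<m}" "j \<in> {..<m}"
    show "(dotp n (col A i) (col A j))\<^sup>2 \<le> (if i = j then 1 else 0) + \<mu>\<^sup>2 / real n"
    proof (cases "i = j")
      case True
      then show ?thesis using incoherent_col_unit[OF inc] ij by simp
    next
      case False
      then have "\<bar>dotp n (col A i) (col A j)\<bar>\<^sup>2 \<le> (\<mu> / sqrt (real n))\<^sup>2"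
        using incoherent_col_dotp[OF inc] ij by (intro power_mono) auto
      then show ?thesis using False by (simp add: power_divide)
    qed
  qed
  also have "\<dots> = real m + (real m)\<^sup>2 * (\<mu>\<^sup>2 / real n)"
    by (simp add: sum.distrib sum.delta power2_eq_square algebra_simps)
  finally have "(real m)\<^sup>2 \<le> real n * (real m + (real m)\<^sup>2 * (\<mu>\<^sup>2 / real n))"
    by (simp add: mult_left_mono)
  then have "real m * real m \<le> real m * (real n + \<mu>\<^sup>2 * real m)"
    using n by (simp add: distrib_left power2_eq_square mult_ac)
  then have "real m \<le> real n + \<mu>\<^sup>2 * real m" using m by simp
  then show ?thesis using m n by (simp add: field_simps)
qed

section \<open>Tail bounds for independent samples\<close>

text \<open>Markov's inequality for the exponential of the sum; under the product measure its
  expectation is the \<open>p\<close>-th power of that of one sample. Both tail bounds below differ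
  only in how they estimate that one factor.\<close>

lemma iid_sum_Chernoff:
  fixes f :: "'a \<Rightarrow> real"
  assumes "prob_space D" and int: "integrable D (\<lambda>x. exp (l * f x))" and l: "l \<ge> 0"
    and mgf: "(\<integral>x. exp (l * f x) \<partial>D) \<le> exp b"
    and [measurable]: "f \<in> borel_measurable D"
  shows "measure (\<Pi>\<^sub>M j\<in>{..<p::nat}. D) {X \<in> space (\<Pi>\<^sub>M j\<in>{..<p}. D). t \<le> (\<Sum>j<p. f (X j))}
    \<le> exp (real p * b - l * t)"
proof -
  interpret D: prob_space D by fact
  interpret P: product_prob_space "\<lambda>_::nat. D" "{..<p}" by standard
  let ?M = "\<Pi>\<^sub>M j\<in>{..<p}. D"
  have exp_sum: "exp (l * (\<Sum>j<p. f (X j))) = (\<Prod>j<p. exp (l * f (X j)))" for X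
    by (simp add: sum_distrib_left exp_sum)
  have integ: "integrable ?M (\<lambda>X. \<Prod>j<p. exp (l * f (X j)))"
    by (rule P.product_integrable_prod) (auto intro: int)
  have val: "(\<integral>X. (\<Prod>j<p. exp (l * f (X j))) \<partial>?M) = (\<integral>x. exp (l * f x) \<partial>D) ^ p"
    by (subst P.product_integral_prod) (auto intro: int)
  have "measure ?M {X \<in> space ?M. t \<le> (\<Sum>j<p. f (X j))}
      \<le> measure ?M {X \<in> space ?M. exp (l * t) \<le> (\<Prod>j<p. exp (l * f (X j)))}"
  proof (rule P.P.finite_measure_mono)
    show "{X \<in> space ?M. t \<le> (\<Sum>j<p. f (X j))}
      \<subseteq> {X \<in> space ?M. exp (l * t) \<le> (\<Prod>j<p. exp (l * f (X j)))}"
      using l by (auto simp flip: exp_sum intro: mult_left_mono)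
  qed measurable
  also have "\<dots> \<le> (\<integral>X. (\<Prod>j<p. exp (l * f (X j))) \<partial>?M) / exp (l * t)"
    by (rule integral_Markov_inequality_measure[OF integ sets.empty_sets])
      (auto intro!: prod_nonneg)
  also have "\<dots> \<le> exp b ^ p / exp (l * t)"
    unfolding val by (intro divide_right_mono power_mono mgf) auto
  also have "\<dots> = exp (real p * b - l * t)"
    by (simp add: exp_diff exp_of_nat_mult)
  finally show ?thesis .
qed

text \<open>Bernstein-type tail bounds, in the range where \<open>exp y \<le> 1 + y + y\<^sup>2\<close>.\<close>

lemma iid_sum_upper_tail:
  fixes f :: "'a \<Rightarrow> real"
  assumes D: "prob_space D" and f[measurable]: "f \<in> borel_measurable D"
    and bd: "AE x in D. \<bar>f x\<bar> \<le> B" and B: "B > 0"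
    and var: "(\<integral>x. (f x)\<^sup>2 \<partial>D) \<le> q * B\<^sup>2" and \<tau>: "0 \<le> \<tau>" "\<tau> \<le> 2 * B"
  shows "measure (\<Pi>\<^sub>M j\<in>{..<p::nat}. D)
      {X \<in> space (\<Pi>\<^sub>M j\<in>{..<p}. D). real p * (\<integral>x. f x \<partial>D) + real p * q * \<tau> \<le> (\<Sum>j<p. f (X j))}
    \<le> exp (- (real p * q * \<tau>\<^sup>2 / (4 * B\<^sup>2)))"
proof -
  interpret D: prob_space D by fact
  \<comment> \<open>Minimises \<open>l\<^sup>2 * (q * B\<^sup>2) - l * (q * \<tau>)\<close>; the
    condition \<open>\<tau> \<le> 2 * B\<close> is what gives \<open>l * B \<le> 1\<close>. The
    factor \<open>q\<close> in the variance bound, a cluster probability in the applications, makes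
    the exponent scale with the expected cluster size.\<close>
  define l where "l = \<tau> / (2 * B\<^sup>2)"
  have l0: "l \<ge> 0" using \<tau> by (simp add: l_def)
  have lB: "l * B \<le> 1" using \<tau> B by (simp add: l_def power2_eq_square field_simps)
  have le: "AE x in D. l * f x \<le> 1"
    using bd
  proof eventually_elim
    case (elim x)
    then have "l * f x \<le> l * B" using l0 by (intro mult_left_mono) auto
    then show ?case using lB by simp
  qed
  have exple: "exp y \<le> 1 + y + y\<^sup>2" if "y \<le> 1" for y :: real
  proof (cases "y \<ge> 0")
    case True then show ?thesis using exp_bound[of y] that by simp
  next
    case False
    then have x: "- y \<ge> 0" by simp
    \<comment> \<open>For negative \<open>y\<close> a lower Taylor bound of \<open>exp (- y)\<close>
      is used; its product with \<open>1 + y + y\<^sup>2\<close> is already at least 1.\<close>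
    have "1 \<le> (1 + y + y\<^sup>2) * (1 + (- y) + (- y)\<^sup>2 / 2)"
    proof -
      have eq: "(1 + y + y\<^sup>2) * (1 + (- y) + (- y)\<^sup>2 / 2) = 1 + (y\<^sup>2 + (- y) ^ 3 + y ^ 4) / 2"
        by (simp add: field_simps power2_eq_square power3_eq_cube power4_eq_xxxx)
      have "0 \<le> y\<^sup>2 + (- y) ^ 3 + y ^ 4"
        using zero_le_power[OF x, of 3] by (intro add_nonneg_nonneg) auto
      then show ?thesis unfolding eq by simp
    qed
    also have "\<dots> \<le> (1 + y + y\<^sup>2) * exp (- y)"
    proof (rule mult_left_mono)
      show "1 + - y + (- y)\<^sup>2 / 2 \<le> exp (- y)" using exp_lower_Taylor_quadratic[OF x] by simp
      have "0 \<le> (y + 1)\<^sup>2" by simp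
      then show "0 \<le> 1 + y + y\<^sup>2" using x by (simp add: power2_eq_square algebra_simps)
    qed
    finally show ?thesis by (simp add: exp_minus field_simps)
  qed
  have intf: "integrable D f"
    by (rule D.integrable_const_bound[OF _ f]) (use bd in auto)
  have intf2: "integrable D (\<lambda>x. (f x)\<^sup>2)"
  proof (rule D.integrable_const_bound[where B = "B\<^sup>2"])
    show "AE x in D. norm ((f x)\<^sup>2) \<le> B\<^sup>2"
      using bd by eventually_elim (simp add: abs_le_square_iff[symmetric])
  qed measurable
  have int: "integrable D (\<lambda>x. exp (l * f x))"
  proof (rule D.integrable_const_bound[where B = "exp 1"])
    show "AE x in D. norm (exp (l * f x)) \<le> exp 1" using le by eventually_elim simp
  qed measurable
  have "(\<integral>x. exp (l * f x) \<partial>D) \<le> (\<integral>x. 1 + l * f x + l\<^sup>2 * (f x)\<^sup>2 \<partial>D)"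
  proof (rule integral_mono_AE[OF int])
    show "integrable D (\<lambda>x. 1 + l * f x + l\<^sup>2 * (f x)\<^sup>2)" using intf intf2 by simp
    show "AE x in D. exp (l * f x) \<le> 1 + l * f x + l\<^sup>2 * (f x)\<^sup>2"
      using le by eventually_elim (simp add: exple flip: power_mult_distrib)
  qed
  also have "\<dots> = 1 + (l * (\<integral>x. f x \<partial>D) + l\<^sup>2 * (\<integral>x. (f x)\<^sup>2 \<partial>D))"
    using intf intf2 by (simp add: D.prob_space)
  also have "\<dots> \<le> exp (l * (\<integral>x. f x \<partial>D) + l\<^sup>2 * (\<integral>x. (f x)\<^sup>2 \<partial>D))"
    by (rule exp_ge_add_one_self)
  also have "\<dots> \<le> exp (l * (\<integral>x. f x \<partial>D) + l\<^sup>2 * (q * B\<^sup>2))"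
    using var by (simp add: mult_left_mono)
  finally have mgf: "(\<integral>x. exp (l * f x) \<partial>D) \<le> exp (l * (\<integral>x. f x \<partial>D) + l\<^sup>2 * (q * B\<^sup>2))" .
  have "l\<^sup>2 * (q * B\<^sup>2) - l * (q * \<tau>) = - (q * \<tau>\<^sup>2 / (4 * B\<^sup>2))"
    using B by (simp add: l_def power2_eq_square field_simps)
  then have "real p * (l\<^sup>2 * (q * B\<^sup>2) - l * (q * \<tau>)) = - (real p * q * \<tau>\<^sup>2 / (4 * B\<^sup>2))"
    by simp
  then have "real p * (l * (\<integral>x. f x \<partial>D) + l\<^sup>2 * (q * B\<^sup>2))
      - l * (real p * (\<integral>x. f x \<partial>D) + real p * q * \<tau>) = - (real p * q * \<tau>\<^sup>2 / (4 * B\<^sup>2))"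
    by (simp add: algebra_simps)
  then show ?thesis
    using iid_sum_Chernoff[OF D int l0 mgf f, of p "real p * (\<integral>x. f x \<partial>D) + real p * q * \<tau>"]
    by simp
qed

text \<open>For values in \<open>[0, B]\<close> the mean alone controls the exponential moment, by
  \<open>exp y \<le> 1 + 2 * y\<close> on the unit interval. The requirement on the mean leaves half
  of the exponent. It is linear in \<open>t / B\<close> instead of quadratic, so a summand as large
  as a multiple of \<open>k\<close> costs one factor \<open>k\<close> and not two.\<close>

lemma iid_sum_nonneg_tail:
  fixes f :: "'a \<Rightarrow> real"
  assumes D: "prob_space D" and f[measurable]: "f \<in> borel_measurable D"
    and bd: "AE x in D. 0 \<le> f x \<and> f x \<le> B" and B: "B > 0"
    and mean: "(\<integral>x. f x \<partial>D) \<le> q * (t / 4)"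
  shows "measure (\<Pi>\<^sub>M j\<in>{..<p::nat}. D)
      {X \<in> space (\<Pi>\<^sub>M j\<in>{..<p}. D). real p * q * t \<le> (\<Sum>j<p. f (X j))}
    \<le> exp (- (real p * q * t / (2 * B)))"
proof -
  interpret D: prob_space D by fact
  define l where "l = 1 / B"
  have l0: "l \<ge> 0" using B by (simp add: l_def)
  have le: "AE x in D. 0 \<le> l * f x \<and> l * f x \<le> 1"
    using bd by eventually_elim (use B in \<open>simp add: l_def\<close>)
  have exple: "exp y \<le> 1 + 2 * y" if "0 \<le> y" "y \<le> 1" for y :: real
  proof -
    have "y\<^sup>2 \<le> y" using that by (simp add: power2_eq_square mult_left_le)
    then show ?thesis using exp_bound[of y] that by simp
  qed
  have intf: "integrable D f"
    by (rule D.integrable_const_bound[where B = B, OF _ f]) (use bd in auto)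
  have int: "integrable D (\<lambda>x. exp (l * f x))"
  proof (rule D.integrable_const_bound[where B = "exp 1"])
    show "AE x in D. norm (exp (l * f x)) \<le> exp 1" using le by eventually_elim simp
  qed measurable
  have "(\<integral>x. exp (l * f x) \<partial>D) \<le> (\<integral>x. 1 + 2 * (l * f x) \<partial>D)"
  proof (rule integral_mono_AE[OF int])
    show "integrable D (\<lambda>x. 1 + 2 * (l * f x))" using intf by simp
    show "AE x in D. exp (l * f x) \<le> 1 + 2 * (l * f x)"
      using le by eventually_elim (use exple in auto)
  qed
  also have "\<dots> = 1 + 2 * l * (\<integral>x. f x \<partial>D)"
    using intf by (simp add: D.prob_space)
  also have "\<dots> \<le> exp (2 * l * (\<integral>x. f x \<partial>D))"
    by (rule exp_ge_add_one_self)
  also have "\<dots> \<le> exp (2 * l * (q * (t / 4)))"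
    using mult_left_mono[OF mean, of "2 * l"] l0 by simp
  finally have mgf: "(\<integral>x. exp (l * f x) \<partial>D) \<le> exp (2 * l * (q * (t / 4)))" .
  have "real p * (2 * l * (q * (t / 4))) - l * (real p * q * t) = - (real p * q * t / (2 * B))"
    using B by (simp add: l_def field_simps)
  then show ?thesis
    using iid_sum_Chernoff[OF D int l0 mgf f, of p "real p * q * t"] by simp
qed

section \<open>Second moments of the sparse model\<close>

text \<open>Transfers the conditional statements of \<open>class_Gamma\<close> to integrals over
  \<open>D\<close> with an indicator.\<close>

lemma (in prob_space) integral_uniform_measure:
  fixes f :: "'a \<Rightarrow> real"
  assumes [measurable]: "N \<in> sets M" "f \<in> borel_measurable M" and N: "measure M N > 0"
  shows "(\<integral>x. f x \<partial>uniform_measure M N) = (\<integral>x. indicator N x * f x \<partial>M) / measure M N"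
proof -
  have "uniform_measure M N = density M (\<lambda>x. ennreal (indicator N x / measure M N))"
    unfolding uniform_measure_def
  proof (rule density_cong)
    show "AE x in M. indicator N x / emeasure M N = ennreal (indicator N x / measure M N)"
      using N divide_ennreal[of 1 "measure M N"]
      by (auto simp: emeasure_eq_measure split: split_indicator)
  qed auto
  then have "(\<integral>x. f x \<partial>uniform_measure M N) = (\<integral>x. (indicator N x / measure M N) * f x \<partial>M)"
    using N by (simp add: integral_real_density)
  then show ?thesis by simp
qed

locale sparse_model =
  fixes m k :: nat and a b C \<kappa> :: real and D :: "(nat \<Rightarrow> real) measure"
  assumes Gamma: "class_Gamma m k a b C D" and moments: "bounded_moments m 2 \<kappa> D"
    and C_ge_1: "C \<ge> 1" and a_pos: "a > 0" and b_pos: "b > 0" and k_pos: "k \<ge> 1"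
begin

sublocale D: prob_space D
  using Gamma by (simp add: class_Gamma_def)

lemma sets_D: "sets D = sets (\<Pi>\<^sub>M i\<in>{..<m}. (borel :: real measure))"
  using Gamma by (simp add: class_Gamma_def)

lemma measurable_coord [measurable]: "i < m \<Longrightarrow> (\<lambda>x. x i) \<in> borel_measurable D"
  unfolding measurable_cong_sets[OF sets_D refl] by (rule measurable_component_singleton) simp

text \<open>Gathers the almost sure properties in a predicate on a single point, so that the
  geometric estimates are pointwise and a null set is removed once at the end.\<close>

definition good :: "(nat \<Rightarrow> real) \<Rightarrow> bool" where
  "good x \<longleftrightarrow> card (supp m x) \<le> k \<and> (\<forall>i\<in>supp m x. x i \<in> {-C..-1} \<union> {1..C})"

lemma AE_good: "AE x in D. good x"
proof -
  have "AE x in D. card (supp m x) \<le> k" "AE x in D. \<forall>i\<in>supp m x. x i \<in> {-C..-1} \<union> {1..C}"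
    using Gamma by (auto simp: class_Gamma_def)
  then show ?thesis by eventually_elim (auto simp: good_def)
qed

lemma good_abs_le: "good x \<Longrightarrow> i < m \<Longrightarrow> \<bar>x i\<bar> \<le> C"
  using C_ge_1 by (cases "x i = 0") (force simp: good_def supp_def)+

lemma good_abs_ge: "good x \<Longrightarrow> i < m \<Longrightarrow> x i \<noteq> 0 \<Longrightarrow> \<bar>x i\<bar> \<ge> 1"
  by (force simp: good_def supp_def)

definition q :: "nat \<Rightarrow> real" where
  "q i = measure D (nonzero_on m D {i})"

lemma q_ge: "i < m \<Longrightarrow> q i \<ge> a * (real k / real m)"
  using Gamma by (simp add: class_Gamma_def q_def)

lemma q_le: "i < m \<Longrightarrow> q i \<le> b * (real k / real m)"
  using Gamma by (simp add: class_Gamma_def q_def)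

lemma q_pos: "i < m \<Longrightarrow> q i > 0"
  using q_ge[of i] a_pos k_pos by (smt (verit) divide_pos_pos less_nat_zero_code mult_pos_pos not_gr_zero of_nat_0_less_iff less_le_trans zero_less_one)

lemma nonzero_on_alt: "S \<subseteq> {..<m} \<Longrightarrow> nonzero_on m D S = {x \<in> space D. \<forall>i\<in>S. x i \<noteq> 0}"
  by (auto simp: nonzero_on_def supp_def)

lemma nonzero_on_sets [measurable]:
  assumes "S \<subseteq> {..<m}"
  shows "nonzero_on m D S \<in> sets D"
proof -
  have "finite S" using assms finite_subset by blast
  then show ?thesis unfolding nonzero_on_alt[OF assms]
    using assms by (intro sets.sets_Collect_finite_All) (auto intro!: measurable_sets)
qed

text \<open>The integrand vanishes unless all three coordinates are nonzero, and conditionally on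
  that event \<open>x j\<close> and \<open>x l\<close> are independent and centred. Taking the event
  for the set \<open>{i, j, l}\<close> also covers \<open>i = j\<close> and \<open>i = l\<close>. A
  null event admits no conditioning and is treated separately.\<close>

lemma cross_moment_zero:
  assumes i: "i < m" and j: "j < m" and l: "l < m" and jl: "j \<noteq> l"
  shows "(\<integral>x. of_bool (x i \<noteq> 0) * (x j * x l) \<partial>D) = 0"
proof -
  define S where "S = {i, j, l}"
  define N where "N = nonzero_on m D S"
  have S: "S \<subseteq> {..<m}" using assms by (auto simp: S_def)
  have N[measurable]: "N \<in> sets D" unfolding N_def by (rule nonzero_on_sets[OF S])
  note [measurable] = measurable_coord[OF j] measurable_coord[OF l]
  have eq: "(\<integral>x. of_bool (x i \<noteq> 0) * (x j * x l) \<partial>D) = (\<integral>x. indicator N x * (x j * x l) \<partial>D)"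
    by (rule Bochner_Integration.integral_cong) (auto simp: N_def nonzero_on_alt[OF S], auto simp: S_def indicator_def)
  show ?thesis
  proof (cases "measure D N > 0")
    case False
    then have "measure D N = 0" using measure_nonneg[of D N] by linarith
    then have "N \<in> null_sets D" by (simp add: D.emeasure_eq_measure null_setsI)
    then have "AE x in D. indicator N x * (x j * x l) = 0"
      using AE_not_in[of N D] by (auto elim: eventually_mono)
    then show ?thesis unfolding eq by (rule integral_eq_zero_AE)
  next
    case True
    let ?U = "uniform_measure D N"
    interpret U: prob_space ?U
      using True by (intro prob_space_uniform_measure) (auto simp: D.emeasure_eq_measure)
    have ind: "U.indep_vars (\<lambda>_. borel) (\<lambda>i x. x i) S"
      and mean: "\<And>i. i \<in> S \<Longrightarrow> (\<integral>x. x i \<partial>?U) = 0"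
      using Gamma S True unfolding class_Gamma_def N_def by blast+
    have ind2: "U.indep_vars (\<lambda>_. borel) (\<lambda>i x. x i) {j, l}"
      by (rule U.indep_vars_subset[OF ind]) (auto simp: S_def)
    have int: "integrable ?U (\<lambda>x. x t)" if "t \<in> {j, l}" for t
    proof (rule U.integrable_const_bound[where B = C])
      have "t < m" using that j l by auto
      have "AE x in D. x \<in> N \<longrightarrow> norm (x t) \<le> C"
        using AE_good by eventually_elim (use good_abs_le \<open>t < m\<close> in auto)
      then show "AE x in ?U. norm (x t) \<le> C"
        by (rule AE_uniform_measureI[OF N])
      show "(\<lambda>x. x t) \<in> borel_measurable ?U"
        using measurable_coord[OF \<open>t < m\<close>] by simp
    qed
    have "(\<integral>x. (\<Prod>t\<in>{j, l}. x t) \<partial>?U) = (\<Prod>t\<in>{j, l}. \<integral>x. x t \<partial>?U)"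
      by (rule U.indep_vars_lebesgue_integral[OF _ ind2 int]) auto
    then have "(\<integral>x. x j * x l \<partial>?U) = 0"
      using jl mean by (simp add: S_def)
    then show ?thesis unfolding eq using True
      by (subst (asm) D.integral_uniform_measure) auto
  qed
qed

text \<open>Not normalised: division by \<open>q i\<close> gives the second moment of coordinate
  \<open>l\<close> inside cluster \<open>i\<close>.\<close>

definition \<theta> :: "nat \<Rightarrow> nat \<Rightarrow> real" where
  "\<theta> i l = (\<integral>x. of_bool (x i \<noteq> 0) * (x l)\<^sup>2 \<partial>D)"

text \<open>\<open>C\<^sup>2\<close> bounds a squared value, \<open>\<kappa>\<^sup>2\<close> the
  correlation of two support events, and \<open>b\<close> comes from
  \<open>q l \<le> b * (k / m)\<close>.\<close>

definition G :: real where "G = C\<^sup>2 * \<kappa>\<^sup>2 * b"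

lemma G_nonneg: "G \<ge> 0"
  using b_pos by (simp add: G_def)

lemma \<theta>_nonneg: "\<theta> i l \<ge> 0"
  by (simp add: \<theta>_def)

lemma integrable_bounded:
  assumes "f \<in> borel_measurable D" and "\<And>x. good x \<Longrightarrow> \<bar>f x\<bar> \<le> B"
  shows "integrable D (f :: _ \<Rightarrow> real)"
proof (rule D.integrable_const_bound[where B = B])
  show "AE x in D. norm (f x) \<le> B" using AE_good by eventually_elim (use assms in auto)
qed fact

lemma integrable_of_bool_prod:
  assumes "i < m" "j < m" "l < m"
  shows "integrable D (\<lambda>x. of_bool (x i \<noteq> 0) * (x j * x l))"
proof (rule integrable_bounded[where B = "C * C"])
  note [measurable] = assms[THEN measurable_coord]
  show "(\<lambda>x. of_bool (x i \<noteq> 0) * (x j * x l)) \<in> borel_measurable D" by measurable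
  show "\<bar>of_bool (x i \<noteq> 0) * (x j * x l)\<bar> \<le> C * C" if "good x" for x
    using good_abs_le[OF that assms(2)] good_abs_le[OF that assms(3)] C_ge_1
    by (auto simp: abs_mult intro!: mult_mono)
qed

lemma integral_of_bool_nonzero: "i < m \<Longrightarrow> (\<integral>x. of_bool (x i \<noteq> 0) \<partial>D) = q i"
proof -
  assume i: "i < m"
  have "(\<integral>x. of_bool (x i \<noteq> 0) \<partial>D) = (\<integral>x. indicator (nonzero_on m D {i}) x \<partial>D)"
    using i by (intro Bochner_Integration.integral_cong) (auto simp: nonzero_on_alt split: split_indicator)
  also have "\<dots> = q i"
    using i by (simp add: q_def nonzero_on_sets)
  finally show ?thesis .
qed

text \<open>The pairwise moment bound enters here: it makes a second coordinate about as rare inside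
  the cluster as it is overall.\<close>

lemma \<theta>_le:
  assumes i: "i < m" and l: "l < m" and il: "i \<noteq> l"
  shows "\<theta> i l \<le> q i * (G * (real k / real m))"
proof -
  let ?N = "nonzero_on m D {i, l}"
  have S: "{i, l} \<subseteq> {..<m}" using i l by auto
  note [measurable] = measurable_coord[OF i] measurable_coord[OF l] nonzero_on_sets[OF S]
  have "\<theta> i l \<le> (\<integral>x. C\<^sup>2 * indicator ?N x \<partial>D)"
    unfolding \<theta>_def
  proof (rule integral_mono_AE)
    show "integrable D (\<lambda>x. of_bool (x i \<noteq> 0) * (x l)\<^sup>2)"
      using integrable_of_bool_prod[OF i l l] by (simp add: power2_eq_square)
    show "integrable D (\<lambda>x. C\<^sup>2 * indicator ?N x)"
      by (intro integrable_bounded[where B = "C\<^sup>2"]) (auto split: split_indicator)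
    show "AE x in D. of_bool (x i \<noteq> 0) * (x l)\<^sup>2 \<le> C\<^sup>2 * indicator ?N x"
      using AE_good AE_space
    proof eventually_elim
      case (elim x)
      have "(x l)\<^sup>2 \<le> C\<^sup>2" using good_abs_le[OF elim(1) l] by (metis abs_le_square_iff abs_of_nonneg abs_ge_zero order_trans)
      then show ?case using elim by (auto simp: nonzero_on_alt[OF S] split: split_indicator)
    qed
  qed
  also have "\<dots> = C\<^sup>2 * measure D ?N" by simp
  also have "\<dots> \<le> C\<^sup>2 * (\<kappa>\<^sup>2 * (q i * q l))"
  proof -
    have "measure D ?N \<le> \<kappa> ^ 2 * (\<Prod>i\<in>{i, l}. q i)"
      using moments[unfolded bounded_moments_def, rule_format, OF S] il by (simp add: q_def)
    then show ?thesis using il by (intro mult_left_mono) auto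
  qed
  also have "\<dots> \<le> C\<^sup>2 * (\<kappa>\<^sup>2 * (q i * (b * (real k / real m))))"
    using q_le[OF l] q_pos[OF i] by (intro mult_left_mono) auto
  finally show ?thesis by (simp add: G_def mult_ac)
qed

text \<open>Cross moments vanish, so only the diagonal survives. One factor ranges over a subset
  \<open>T\<close>, which lets the residual, where coordinate \<open>i\<close> is missing, be paired
  with a sum over all coordinates.\<close>

lemma bilinear_moment:
  assumes i: "i < m" and T: "T \<subseteq> {..<m}"
  shows "(\<integral>x. of_bool (x i \<noteq> 0) * ((\<Sum>l\<in>T. u l * x l) * (\<Sum>l<m. v l * x l)) \<partial>D)
    = (\<Sum>l\<in>T. u l * v l * \<theta> i l)"
proof -
  have fin: "finite T" using T finite_subset by blast
  have "(\<integral>x. of_bool (x i \<noteq> 0) * ((\<Sum>l\<in>T. u l * x l) * (\<Sum>l<m. v l * x l)) \<partial>D)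
    = (\<integral>x. (\<Sum>l\<in>T. \<Sum>j<m. u l * v j * (of_bool (x i \<noteq> 0) * (x l * x j))) \<partial>D)"
    unfolding sum_product unfolding sum_distrib_left
    by (intro Bochner_Integration.integral_cong sum.cong refl) (simp only: mult_ac)
  also have "\<dots> = (\<Sum>l\<in>T. \<Sum>j<m. u l * v j * (\<integral>x. of_bool (x i \<noteq> 0) * (x l * x j) \<partial>D))"
    using T i by (subst Bochner_Integration.integral_sum;
      (intro sum.cong refl integrable_sum integrable_mult_right integrable_of_bool_prod)?)
      (auto simp: integrable_of_bool_prod subset_iff)
  also have "\<dots> = (\<Sum>l\<in>T. \<Sum>j<m. if l = j then u l * v l * \<theta> i l else 0)"
    using T i cross_moment_zero by (intro sum.cong refl) (auto simp: \<theta>_def power2_eq_square subset_iff)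
  also have "\<dots> = (\<Sum>l\<in>T. u l * v l * \<theta> i l)"
    using T by (intro sum.cong refl) (auto simp: subset_iff)
  finally show ?thesis .
qed

end

section \<open>Recovery of one column\<close>

text \<open>The points are the multiples of \<open>1 / L\<close> in the cube, and a unit vector is
  approximated by rounding each coordinate down. The condition \<open>n \<le> L\<^sup>2\<close>
  bounds the rounding error by 1, so the rounded vector survives the restriction to squared norm at
  most 4.\<close>

lemma unit_vector_net:
  assumes L: "L \<ge> 1" "n \<le> L\<^sup>2"
  obtains F :: "(nat \<Rightarrow> real) set" where "finite F" "card F \<le> (2 * L + 1) ^ n"
    "\<And>y. y \<in> F \<Longrightarrow> dotp n y y \<le> 4"
    "\<And>w. dotp n w w = 1 \<Longrightarrow> \<exists>y\<in>F. dotp n (\<lambda>r. w r - y r) (\<lambda>r. w r - y r) \<le> real n / (real L)\<^sup>2"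
proof -
  define Z where "Z = (\<Pi>\<^sub>E r\<in>{..<n}. {- int L .. int L})"
  define P where "P = (\<lambda>z::nat \<Rightarrow> int. \<lambda>r. real_of_int (z r) / real L)"
  define F where "F = {y \<in> P ` Z. dotp n y y \<le> 4}"
  have finZ: "finite Z" unfolding Z_def by (intro finite_PiE) auto
  have cardZ: "card Z = (2 * L + 1) ^ n"
    unfolding Z_def by (subst card_PiE) (auto simp: nat_add_distrib nat_mult_distrib)
  have Fsub: "F \<subseteq> P ` Z" by (auto simp: F_def)
  show ?thesis
  proof (rule that)
    show "finite F" using Fsub finZ by (meson finite_imageI finite_subset)
    show "card F \<le> (2 * L + 1) ^ n"
      using card_mono[OF finite_imageI[OF finZ] Fsub] card_image_le[OF finZ, of P] cardZ by simp
    show "dotp n y y \<le> 4" if "y \<in> F" for y using that by (simp add: F_def)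
    show "\<exists>y\<in>F. dotp n (\<lambda>r. w r - y r) (\<lambda>r. w r - y r) \<le> real n / (real L)\<^sup>2" if w: "dotp n w w = 1" for w
    proof -
      define z where "z = (\<lambda>r\<in>{..<n}. \<lfloor>real L * w r\<rfloor>)"
      define y where "y = P z"
      have Lpos: "real L > 0" using L by simp
      have zZ: "z \<in> Z"
      proof -
        have "\<lfloor>real L * w r\<rfloor> \<in> {- int L .. int L}" if "r < n" for r
        proof -
          have "\<bar>w r\<bar> \<le> 1"
            using component_sq_le_dotp[OF that, of w] w by (simp add: abs_square_le_1)
          then have "\<bar>real L * w r\<bar> \<le> real L" by (simp add: abs_mult mult_left_le)
          then show ?thesis by (simp add: abs_le_iff le_floor_iff floor_le_iff)
        qed
        then show ?thesis by (auto simp: Z_def z_def)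
      qed
      have diff: "(w r - y r)\<^sup>2 \<le> 1 / (real L)\<^sup>2" if "r < n" for r
      proof -
        have "\<bar>real L * w r - real_of_int \<lfloor>real L * w r\<rfloor>\<bar> \<le> 1" by linarith
        then have "(real L * w r - real_of_int \<lfloor>real L * w r\<rfloor>)\<^sup>2 \<le> 1"
          by (simp add: abs_square_le_1)
        moreover have "w r - y r = (real L * w r - real_of_int \<lfloor>real L * w r\<rfloor>) / real L"
          using that Lpos by (simp add: y_def P_def z_def field_simps)
        ultimately show ?thesis using Lpos by (simp add: power_divide divide_right_mono)
      qed
      have dd: "dotp n (\<lambda>r. w r - y r) (\<lambda>r. w r - y r) \<le> real n / (real L)\<^sup>2"
        using sum_bounded_above[of "{..<n}" "\<lambda>r. (w r - y r)\<^sup>2" "1 / (real L)\<^sup>2"] diff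
        by (simp add: dotp_def power2_eq_square)
      also have "\<dots> \<le> 1"
        using L by (simp add: field_simps flip: of_nat_power)
      finally have d1: "dotp n (\<lambda>r. w r - y r) (\<lambda>r. w r - y r) \<le> 1" .
      have "dotp n y y \<le> 2 * dotp n w w + 2 * dotp n (\<lambda>r. w r - y r) (\<lambda>r. w r - y r)"
        unfolding dotp_def sum_distrib_left sum.distrib[symmetric]
      proof (rule sum_mono)
        fix r
        \<comment> \<open>This square is exactly the difference of the two sides of the
          goal.\<close>
        have "0 \<le> (2 * w r - y r)\<^sup>2" by simp
        then show "y r * y r \<le> 2 * (w r * w r) + 2 * ((w r - y r) * (w r - y r))"
          by (simp add: power2_eq_square algebra_simps)
      qed
      then have "y \<in> F" using d1 w zZ by (auto simp: F_def y_def)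
      then show ?thesis using dd by blast
    qed
  qed
qed

text \<open>Expresses the bilinear form as an average of products of inner products with the
  samples; entries of the covariance matrix do not appear in the estimates after this.\<close>

lemma cluster_covariance_form:
  "dotp n v (mat_vec n (cluster_covariance Y S) w)
    = (\<Sum>j\<in>S. dotp n v (Y j) * dotp n (Y j) w) / real (card S)"
proof -
  have "mat_vec n (cluster_covariance Y S) w
      = (\<lambda>r. (1 / real (card S)) * (\<Sum>j\<in>S. dotp n (Y j) w * Y j r))"
  proof
    fix r
    have "mat_vec n (cluster_covariance Y S) w r
        = (1 / real (card S)) * (\<Sum>s<n. \<Sum>j\<in>S. Y j r * Y j s * w s)"
      by (simp add: mat_vec_def cluster_covariance_def sum_distrib_left sum_distrib_right mult_ac)
    also have "(\<Sum>s<n. \<Sum>j\<in>S. Y j r * Y j s * w s) = (\<Sum>j\<in>S. \<Sum>s<n. Y j r * Y j s * w s)"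
      by (rule sum.swap)
    also have "\<dots> = (\<Sum>j\<in>S. dotp n (Y j) w * Y j r)"
      by (simp add: dotp_def sum_distrib_right sum_distrib_left mult_ac)
    finally show "mat_vec n (cluster_covariance Y S) w r
        = (1 / real (card S)) * (\<Sum>j\<in>S. dotp n (Y j) w * Y j r)" .
  qed
  then show ?thesis
    by (simp only: dotp_scale_right dotp_sum_right) (simp add: mult_ac)
qed

lemma cluster_covariance_sym: "cluster_covariance Y S r s = cluster_covariance Y S s r"
  by (simp add: cluster_covariance_def mult.commute)

text \<open>The bound \<open>small\<close> keeps the interference of at most \<open>k\<close> other
  columns with column \<open>i\<close> below 1/4, a fixed fraction of the least nonzero value
  1.\<close>

locale cluster_model = sparse_model +
  fixes n :: nat and \<mu> :: real and A :: "nat \<Rightarrow> nat \<Rightarrow> real" and i :: nat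
  assumes inc: "incoherent n m \<mu> A" and \<mu>_pos: "\<mu> > 0" and i: "i < m" and n_pos: "n > 0"
    and small: "C * (real k * (\<mu> / sqrt (real n))) \<le> 1 / 4"
begin

section \<open>Pointwise estimates for one sample\<close>

definition others :: "nat set" where "others = {..<m} - {i}"

definition \<epsilon> :: real where "\<epsilon> = \<mu> / sqrt (real n)"

definition e :: "nat \<Rightarrow> real" where "e = col A i"

text \<open>\<open>e\<close>, \<open>res x\<close> and \<open>ov x\<close> are \<open>A\<^sub>i\<close>, \<open>Y' = Y - X\<^sub>i A\<^sub>i\<close> and \<open>\<langle>Y, A\<^sub>i\<rangle>\<close>.\<close>

definition res :: "(nat \<Rightarrow> real) \<Rightarrow> nat \<Rightarrow> real" where
  "res x = (\<lambda>r. \<Sum>l\<in>others. x l * col A l r)"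

definition ov :: "(nat \<Rightarrow> real) \<Rightarrow> real" where
  "ov x = dotp n (mat_vec m A x) e"

lemma others_subset: "others \<subseteq> {..<m}" by (auto simp: others_def)

lemma finite_others [simp]: "finite others" by (simp add: others_def)

lemma card_others_le: "real (card others) \<le> real m"
  using card_mono[OF _ others_subset] by simp

lemma \<epsilon>_pos: "\<epsilon> > 0" using \<mu>_pos n_pos by (simp add: \<epsilon>_def)

lemma e_unit: "dotp n e e = 1"
  unfolding e_def by (rule incoherent_col_unit[OF inc i])

lemma col_e_le: "l \<in> others \<Longrightarrow> \<bar>dotp n (col A l) e\<bar> \<le> \<epsilon>"
  unfolding e_def others_def \<epsilon>_def using incoherent_col_dotp[OF inc _ i] by auto

lemma mat_vec_split: "mat_vec m A x = (\<lambda>r. x i * e r + res x r)"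
proof
  fix r
  have "mat_vec m A x r = (\<Sum>l<m. x l * col A l r)"
    by (simp add: mat_vec_def col_def mult.commute)
  also have "\<dots> = x i * col A i r + (\<Sum>l\<in>others. x l * col A l r)"
    unfolding others_def using i by (subst sum.remove[of _ i]) auto
  finally show "mat_vec m A x r = x i * e r + res x r" by (simp add: e_def res_def)
qed

lemma ov_eq: "ov x = (\<Sum>l<m. dotp n (col A l) e * x l)"
proof -
  have "mat_vec m A x = (\<lambda>r. \<Sum>l<m. x l * col A l r)"
    by (simp add: mat_vec_def col_def mult.commute)
  then show ?thesis by (simp add: ov_def dotp_sum_left dotp_scale_left mult.commute)
qed

lemma dotp_res: "dotp n y (res x) = (\<Sum>l\<in>others. dotp n y (col A l) * x l)"
  unfolding res_def dotp_sum_right dotp_scale_right by (simp add: mult.commute)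

lemma sum_others_supp: "(\<Sum>l\<in>others. x l * f l) = (\<Sum>l\<in>supp m x - {i}. x l * (f l :: real))"
  by (rule sum.mono_neutral_right) (auto simp: others_def supp_def)

lemma card_supp_le: "good x \<Longrightarrow> real (card (supp m x - {i})) \<le> real k"
  using card_mono[of "supp m x" "supp m x - {i}"] by (force simp: good_def supp_def)

text \<open>Near-orthogonality of the at most \<open>k\<close> active columns makes the squared norm
  linear in \<open>k\<close>, where the triangle inequality would give \<open>k\<close> squared.
  This linear growth is what the exponents of the tail bounds can afford.\<close>

lemma res_norm:
  assumes x: "good x"
  shows "dotp n (res x) (res x) \<le> 2 * C\<^sup>2 * real k"
proof -
  let ?T = "supp m x - {i}"
  have T: "?T \<subseteq> {..<m}" by (auto simp: supp_def)
  have r: "res x = (\<lambda>r. \<Sum>l\<in>?T. x l * col A l r)" by (simp add: res_def sum_others_supp)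
  have "dotp n (res x) (res x) \<le> (1 + real (card ?T) * \<epsilon>) * (\<Sum>l\<in>?T. (x l)\<^sup>2)"
    unfolding r using \<mu>_pos by (intro incoherent_synthesis_bound[OF inc _ T, folded \<epsilon>_def]) simp
  also have "\<dots> \<le> 2 * (real k * C\<^sup>2)"
  proof (rule mult_mono)
    have "real (card ?T) * \<epsilon> \<le> real k * \<epsilon>"
      using card_supp_le[OF x] \<epsilon>_pos by (intro mult_right_mono) auto
    also have "\<dots> \<le> C * (real k * \<epsilon>)" using C_ge_1 \<epsilon>_pos mult_right_mono[of 1 C "real k * \<epsilon>"] by simp
    finally show "1 + real (card ?T) * \<epsilon> \<le> 2" using small[folded \<epsilon>_def] by simp
    have "(x l)\<^sup>2 \<le> C\<^sup>2" if "l \<in> ?T" for l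
      using good_abs_le[OF x, of l] that T C_ge_1 by (auto simp: abs_le_square_iff[symmetric])
    then have "(\<Sum>l\<in>?T. (x l)\<^sup>2) \<le> real (card ?T) * C\<^sup>2"
      using sum_bounded_above[of ?T "\<lambda>l. (x l)\<^sup>2" "C\<^sup>2"] by simp
    also have "\<dots> \<le> real k * C\<^sup>2" using card_supp_le[OF x] by (intro mult_right_mono) auto
    finally show "(\<Sum>l\<in>?T. (x l)\<^sup>2) \<le> real k * C\<^sup>2" .
  qed (auto simp: sum_nonneg)
  finally show ?thesis by (simp add: mult_ac)
qed

lemma ov_near:
  assumes x: "good x"
  shows "\<bar>ov x - x i\<bar> \<le> 1 / 4"
proof -
  let ?T = "supp m x - {i}"
  have T: "?T \<subseteq> others" by (auto simp: supp_def others_def)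
  have "ov x - x i = dotp n (res x) e"
    unfolding ov_def mat_vec_split dotp_linear e_unit by simp
  also have "\<dots> = (\<Sum>l\<in>others. x l * dotp n (col A l) e)"
    unfolding dotp_commute[of n _ e] dotp_res by (simp add: mult.commute)
  also have "\<dots> = (\<Sum>l\<in>?T. x l * dotp n (col A l) e)" by (rule sum_others_supp)
  finally have "\<bar>ov x - x i\<bar> \<le> (\<Sum>l\<in>?T. \<bar>x l * dotp n (col A l) e\<bar>)" by simp
  also have "\<dots> \<le> (\<Sum>l\<in>?T. C * \<epsilon>)"
  proof (rule sum_mono)
    fix l assume "l \<in> ?T"
    then have "l \<in> others" "l < m" using T by (auto simp: others_def)
    then show "\<bar>x l * dotp n (col A l) e\<bar> \<le> C * \<epsilon>"
      using good_abs_le[OF x, of l] col_e_le[of l] C_ge_1 unfolding abs_mult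
      by (intro mult_mono) auto
  qed
  also have "\<dots> = real (card ?T) * (C * \<epsilon>)" by simp
  also have "\<dots> \<le> real k * (C * \<epsilon>)"
    using card_supp_le[OF x] C_ge_1 \<epsilon>_pos by (intro mult_right_mono) auto
  finally show ?thesis using small[folded \<epsilon>_def] by (simp add: mult_ac)
qed

lemma ov_abs_le: "good x \<Longrightarrow> \<bar>ov x\<bar> \<le> 2 * C"
  using ov_near[of x] good_abs_le[of x i] i C_ge_1 by linarith

text \<open>The square of 3/4 exceeds 1/2. Averaged over the cluster this bounds the Rayleigh
  quotient of \<open>e\<close> from below without any concentration argument.\<close>

lemma ov_sq_ge: "good x \<Longrightarrow> x i \<noteq> 0 \<Longrightarrow> (ov x)\<^sup>2 \<ge> 1 / 2"
proof -
  assume "good x" "x i \<noteq> 0"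
  then have "\<bar>ov x\<bar> \<ge> 3 / 4" using ov_near[of x] good_abs_ge[of x i] i by linarith
  then have "\<bar>ov x\<bar>\<^sup>2 \<ge> (3 / 4)\<^sup>2" by (intro power_mono) auto
  then show ?thesis by (simp add: power2_eq_square)
qed

section \<open>Measurability and expectations over the cluster\<close>

lemma measurable_dotp_res [measurable]: "(\<lambda>x. dotp n y (res x)) \<in> borel_measurable D"
  unfolding dotp_res using others_subset by (intro borel_measurable_sum borel_measurable_times) auto

lemma measurable_res [measurable]: "(\<lambda>x. res x r) \<in> borel_measurable D"
  unfolding res_def using others_subset by (intro borel_measurable_sum borel_measurable_times) auto

lemma measurable_ov [measurable]: "ov \<in> borel_measurable D"
  unfolding ov_eq[abs_def] by (intro borel_measurable_sum borel_measurable_times) auto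

lemma measurable_in_cluster [measurable]: "(\<lambda>x. of_bool (x i \<noteq> 0) :: real) \<in> borel_measurable D"
  using measurable_coord[OF i] by measurable

text \<open>The systematic part of the off-diagonal block, before division by \<open>q i\<close>;
  more samples do not reduce it.\<close>

definition bias :: "nat \<Rightarrow> real" where
  "bias r = (\<integral>x. of_bool (x i \<noteq> 0) * (res x r * ov x) \<partial>D)"

text \<open>The bias is a combination of the other columns with coefficients at most
  \<open>K\<close>: each contains one factor \<epsilon> from the overlap with \<open>e\<close> and
  one factor \<open>k / m\<close> from \<open>\<theta>_le\<close>. The synthesis bound over all of
  \<open>others\<close> turns this into \<open>q i * (k * \<epsilon>)\<close> times the root of
  \<open>G\<^sup>2 * (1 / m + \<epsilon>)\<close>. That root, at most 1/32, is the gain beyond the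
  order of \<zeta>.\<close>

lemma bias_norm:
  assumes bs: "G\<^sup>2 * (1 / real m + \<epsilon>) \<le> 1 / 1024" and z: "real k * \<epsilon> \<le> \<zeta>"
  shows "sqrt (dotp n bias bias) \<le> q i * (\<zeta> / 32)"
proof -
  have z0: "\<zeta> \<ge> 0" using z \<epsilon>_pos by (smt (verit) of_nat_0_le_iff mult_nonneg_nonneg)
  define v where "v = (\<lambda>l. dotp n (col A l) e * \<theta> i l)"
  have b: "bias = (\<lambda>r. \<Sum>l\<in>others. v l * col A l r)"
  proof
    fix r
    have "bias r = (\<integral>x. of_bool (x i \<noteq> 0) * ((\<Sum>l\<in>others. col A l r * x l) * (\<Sum>l<m. dotp n (col A l) e * x l)) \<partial>D)"
      by (simp add: bias_def res_def ov_eq mult_ac)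
    also have "\<dots> = (\<Sum>l\<in>others. v l * col A l r)"
      unfolding bilinear_moment[OF i others_subset] by (simp add: v_def mult_ac)
    finally show "bias r = (\<Sum>l\<in>others. v l * col A l r)" .
  qed
  define K where "K = \<epsilon> * (q i * (G * (real k / real m)))"
  have m0: "real m > 0" using i by simp
  have K0: "K \<ge> 0" using \<epsilon>_pos q_pos[OF i] G_nonneg by (simp add: K_def)
  have vK: "(v l)\<^sup>2 \<le> K\<^sup>2" if "l \<in> others" for l
  proof -
    have "\<bar>v l\<bar> \<le> K" unfolding v_def K_def abs_mult
      using col_e_le[OF that] \<theta>_le[OF i, of l] \<theta>_nonneg[of i l] that \<epsilon>_pos
      by (intro mult_mono) (auto simp: others_def)
    then show ?thesis using K0 by (simp add: abs_le_square_iff[symmetric])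
  qed
  have "dotp n bias bias \<le> (1 + real (card others) * \<epsilon>) * (\<Sum>l\<in>others. (v l)\<^sup>2)"
    unfolding b using \<mu>_pos by (intro incoherent_synthesis_bound[OF inc _ others_subset, folded \<epsilon>_def]) simp
  also have "\<dots> \<le> (1 + real m * \<epsilon>) * (real m * K\<^sup>2)"
  proof (rule mult_mono)
    show "1 + real (card others) * \<epsilon> \<le> 1 + real m * \<epsilon>"
      using card_others_le \<epsilon>_pos by (intro add_left_mono mult_right_mono) auto
    have "(\<Sum>l\<in>others. (v l)\<^sup>2) \<le> real (card others) * K\<^sup>2"
      using sum_bounded_above[of others "\<lambda>l. (v l)\<^sup>2" "K\<^sup>2"] vK by simp
    also have "\<dots> \<le> real m * K\<^sup>2" using card_others_le by (intro mult_right_mono) auto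
    finally show "(\<Sum>l\<in>others. (v l)\<^sup>2) \<le> real m * K\<^sup>2" .
  qed (use \<epsilon>_pos in \<open>auto simp: sum_nonneg\<close>)
  also have "\<dots> = (q i)\<^sup>2 * (real k * \<epsilon>)\<^sup>2 * (G\<^sup>2 * (1 / real m + \<epsilon>))"
  proof -
    have mK: "real m * K\<^sup>2 = (q i)\<^sup>2 * (real k * \<epsilon>)\<^sup>2 * G\<^sup>2 * (1 / real m)"
      using m0 unfolding K_def power_mult_distrib power_divide by (simp add: power2_eq_square)
    have "(1 + real m * \<epsilon>) * (1 / real m) = 1 / real m + \<epsilon>"
      using m0 by (simp add: field_simps)
    moreover have "(1 + real m * \<epsilon>) * (real m * K\<^sup>2)
        = (q i)\<^sup>2 * (real k * \<epsilon>)\<^sup>2 * (G\<^sup>2 * ((1 + real m * \<epsilon>) * (1 / real m)))"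
      unfolding mK by (simp only: mult_ac)
    ultimately show ?thesis by simp
  qed
  also have "\<dots> \<le> (q i)\<^sup>2 * \<zeta>\<^sup>2 * (1 / 1024)"
    using bs z \<epsilon>_pos q_pos[OF i] by (intro mult_mono power_mono) (auto simp: G_nonneg)
  also have "\<dots> = (q i * (\<zeta> / 32))\<^sup>2" by (simp add: power_mult_distrib power_divide)
  finally have "dotp n bias bias \<le> (q i * (\<zeta> / 32))\<^sup>2" .
  then show ?thesis using q_pos[OF i] z0 by (intro real_le_lsqrt) auto
qed

text \<open>The second moment of the residual in a direction \<open>y\<close> is a weighted sum of
  squared inner products with the columns. The analysis bound loses
  \<open>1 + m * \<epsilon>\<close>, but the weights carry \<open>k / m\<close>, and the product
  \<open>k / m + k * \<epsilon>\<close> is small.\<close>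

lemma mean_res_sq:
  "(\<integral>x. of_bool (x i \<noteq> 0) * (dotp n y (res x))\<^sup>2 \<partial>D)
    \<le> q i * (G * (real k / real m + real k * \<epsilon>)) * dotp n y y"
proof -
  \<comment> \<open>The value 0 at \<open>i\<close> lets the residual be written as a sum over all
    coordinates, as \<open>bilinear_moment\<close> requires.\<close>
  define v where "v = (\<lambda>l. if l = i then 0 else dotp n y (col A l))"
  have s: "(\<Sum>l<m. v l * x l) = dotp n y (res x)" for x
    unfolding dotp_res by (rule sum.mono_neutral_cong_right) (auto simp: others_def v_def)
  have m0: "real m > 0" using i by simp
  have "(\<integral>x. of_bool (x i \<noteq> 0) * (dotp n y (res x))\<^sup>2 \<partial>D)
      = (\<integral>x. of_bool (x i \<noteq> 0) * ((\<Sum>l\<in>others. dotp n y (col A l) * x l) * (\<Sum>l<m. v l * x l)) \<partial>D)"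
    unfolding s dotp_res[symmetric] power2_eq_square ..
  also have "\<dots> = (\<Sum>l\<in>others. (dotp n y (col A l))\<^sup>2 * \<theta> i l)"
    unfolding bilinear_moment[OF i others_subset]
    by (rule sum.cong) (auto simp: v_def others_def power2_eq_square)
  also have "\<dots> \<le> (\<Sum>l\<in>others. (dotp n y (col A l))\<^sup>2 * (q i * (G * (real k / real m))))"
    using \<theta>_le[OF i] by (intro sum_mono mult_left_mono) (auto simp: others_def)
  also have "\<dots> = (q i * (G * (real k / real m))) * (\<Sum>l\<in>others. (dotp n y (col A l))\<^sup>2)"
    unfolding sum_distrib_left by (simp only: mult.commute)
  also have "\<dots> \<le> (q i * (G * (real k / real m))) * ((1 + real m * \<epsilon>) * dotp n y y)"
  proof (rule mult_left_mono)
    have "(\<Sum>l\<in>others. (dotp n y (col A l))\<^sup>2) \<le> (1 + real (card others) * \<epsilon>) * dotp n y y"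
      using \<mu>_pos by (intro incoherent_analysis_bound[OF inc _ others_subset, folded \<epsilon>_def]) simp
    also have "\<dots> \<le> (1 + real m * \<epsilon>) * dotp n y y"
      using \<epsilon>_pos card_others_le by (intro mult_right_mono add_left_mono) auto
    finally show "(\<Sum>l\<in>others. (dotp n y (col A l))\<^sup>2) \<le> (1 + real m * \<epsilon>) * dotp n y y" .
    show "0 \<le> q i * (G * (real k / real m))" using q_pos[OF i] G_nonneg by simp
  qed
  also have "\<dots> = q i * (G * ((real k / real m) * (1 + real m * \<epsilon>))) * dotp n y y"
    by (simp only: mult_ac)
  also have "(real k / real m) * (1 + real m * \<epsilon>) = real k / real m + real k * \<epsilon>"
    using m0 by (simp add: distrib_left)
  finally show ?thesis .
qed

section \<open>Tail bounds for the cluster size, the coordinates and the quadratic form\<close>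

lemma cluster_size_tail:
  "measure (\<Pi>\<^sub>M j\<in>{..<p::nat}. D) {X \<in> space (\<Pi>\<^sub>M j\<in>{..<p}. D).
      (\<Sum>j<p. of_bool (X j i \<noteq> 0)) \<le> real p * q i / 2} \<le> exp (- (real p * q i / 16))"
proof -
  \<comment> \<open>A lower tail is the upper tail of the negated indicator; with
    \<open>\<tau> = 1 / 2\<close> and \<open>B = 1\<close> the exponent is
    \<open>p * q i / 16\<close>.\<close>
  let ?f = "\<lambda>x. - (of_bool (x i \<noteq> 0) :: real)"
  have m: "?f \<in> borel_measurable D" by (intro borel_measurable_uminus measurable_in_cluster)
  have eq: "(?f x)\<^sup>2 = of_bool (x i \<noteq> 0)" for x :: "nat \<Rightarrow> real" by simp
  have "measure (\<Pi>\<^sub>M j\<in>{..<p}. D) {X \<in> space (\<Pi>\<^sub>M j\<in>{..<p}. D).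
      real p * (\<integral>x. ?f x \<partial>D) + real p * q i * (1 / 2) \<le> (\<Sum>j<p. ?f (X j))}
    \<le> exp (- (real p * q i * (1 / 2)\<^sup>2 / (4 * 1\<^sup>2)))"
  proof (rule iid_sum_upper_tail[OF D.prob_space_axioms m])
    show "(\<integral>x. (?f x)\<^sup>2 \<partial>D) \<le> q i * 1\<^sup>2" unfolding eq integral_of_bool_nonzero[OF i] by simp
  qed (use q_pos[OF i] in auto)
  moreover have "real p * (\<integral>x. ?f x \<partial>D) + real p * q i * (1 / 2) \<le> (\<Sum>j<p. ?f (X j))
      \<longleftrightarrow> (\<Sum>j<p. of_bool (X j i \<noteq> 0)) \<le> real p * q i / 2" for X :: "nat \<Rightarrow> nat \<Rightarrow> real"
    unfolding sum_negf using integral_of_bool_nonzero[OF i] by (simp add: field_simps)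
  ultimately show ?thesis by (simp add: power2_eq_square)
qed

text \<open>The sign \<open>s\<close> yields both tails from one proof. The bound \<open>B\<close>
  multiplies \<open>3 / 2 * C * sqrt k\<close> for a residual coordinate by \<open>2 * C\<close> for
  the overlap, and the indicator inside the square brings the second moment down to
  \<open>q i * B\<^sup>2\<close>.\<close>

lemma coordinate_tail:
  assumes s: "s \<in> {1, -1}" and r: "r < n" and \<tau>: "0 \<le> \<tau>" "\<tau> \<le> 1"
  shows "measure (\<Pi>\<^sub>M j\<in>{..<p::nat}. D) {X \<in> space (\<Pi>\<^sub>M j\<in>{..<p}. D).
      real p * (s * bias r) + real p * q i * \<tau>
        \<le> (\<Sum>j<p. s * (of_bool (X j i \<noteq> 0) * (res (X j) r * ov (X j))))}
    \<le> exp (- (real p * q i * \<tau>\<^sup>2 / (36 * C ^ 4 * real k)))"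
proof -
  let ?f = "\<lambda>x. s * (of_bool (x i \<noteq> 0) * (res x r * ov x))"
  define B where "B = 3 * C\<^sup>2 * sqrt (real k)"
  have k1: "sqrt (real k) \<ge> 1" using k_pos by simp
  have C2: "C\<^sup>2 \<ge> 1" using C_ge_1 by simp
  have B1: "B \<ge> 1"
  proof -
    have "1 * 1 \<le> (3 * C\<^sup>2) * sqrt (real k)" using k1 C2 by (intro mult_mono) auto
    then show ?thesis by (simp add: B_def)
  qed
  have m: "?f \<in> borel_measurable D" by measurable
  have bd: "\<bar>res x r * ov x\<bar> \<le> B" if x: "good x" for x
  proof -
    have "(res x r)\<^sup>2 \<le> 2 * C\<^sup>2 * real k"
      using component_sq_le_dotp[OF r, of "res x"] res_norm[OF x] by simp
    also have "\<dots> \<le> (3 / 2 * C * sqrt (real k))\<^sup>2"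
      by (simp add: power_mult_distrib power_divide mult_right_mono)
    finally have "\<bar>res x r\<bar> \<le> 3 / 2 * C * sqrt (real k)"
      using C_ge_1 by (simp add: abs_le_square_iff[symmetric])
    then have "\<bar>res x r * ov x\<bar> \<le> (3 / 2 * C * sqrt (real k)) * (2 * C)"
      unfolding abs_mult using ov_abs_le[OF x] C_ge_1 by (intro mult_mono) auto
    then show ?thesis by (simp add: B_def power2_eq_square mult_ac)
  qed
  have sq: "s\<^sup>2 = 1" "\<bar>s\<bar> = 1" using s by auto
  have mean: "(\<integral>x. ?f x \<partial>D) = s * bias r" by (simp add: bias_def)
  have B2: "4 * B\<^sup>2 = 36 * C ^ 4 * real k"
    by (simp add: B_def power_mult_distrib flip: power_mult)
  have "measure (\<Pi>\<^sub>M j\<in>{..<p}. D) {X \<in> space (\<Pi>\<^sub>M j\<in>{..<p}. D).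
      real p * (\<integral>x. ?f x \<partial>D) + real p * q i * \<tau> \<le> (\<Sum>j<p. ?f (X j))}
    \<le> exp (- (real p * q i * \<tau>\<^sup>2 / (4 * B\<^sup>2)))"
  proof (rule iid_sum_upper_tail[OF D.prob_space_axioms m])
    show "AE x in D. \<bar>?f x\<bar> \<le> B"
      using AE_good
    proof eventually_elim
      case (elim x)
      then show ?case using bd[OF elim] B1 sq by (auto simp: abs_mult)
    qed
    have "(\<integral>x. (?f x)\<^sup>2 \<partial>D) \<le> (\<integral>x. of_bool (x i \<noteq> 0) * B\<^sup>2 \<partial>D)"
    proof (rule integral_mono_AE)
      have le: "(?f x)\<^sup>2 \<le> of_bool (x i \<noteq> 0) * B\<^sup>2" if "good x" for x
        using bd[OF that] B1 sq by (auto simp: power_mult_distrib[of s] abs_le_square_iff[symmetric])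
      have le2: "of_bool (x i \<noteq> 0) * B\<^sup>2 \<le> B\<^sup>2" for x :: "nat \<Rightarrow> real" by simp
      show "integrable D (\<lambda>x. (?f x)\<^sup>2)"
      proof (rule integrable_bounded[where B = "B\<^sup>2"])
        show "\<bar>(?f x)\<^sup>2\<bar> \<le> B\<^sup>2" if "good x" for x
          using le[OF that] le2[of x] by simp
      qed measurable
      show "integrable D (\<lambda>x. of_bool (x i \<noteq> 0) * B\<^sup>2)"
        by (rule integrable_bounded[where B = "B\<^sup>2"]) auto
      show "AE x in D. (?f x)\<^sup>2 \<le> of_bool (x i \<noteq> 0) * B\<^sup>2"
        using AE_good by eventually_elim (rule le)
    qed
    also have "\<dots> = q i * B\<^sup>2" using integral_of_bool_nonzero[OF i] by simp
    finally show "(\<integral>x. (?f x)\<^sup>2 \<partial>D) \<le> q i * B\<^sup>2" .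
  qed (use q_pos[OF i] B1 \<tau> in auto)
  then show ?thesis unfolding mean B2 .
qed

text \<open>A summand is at most \<open>4 * (2 * C\<^sup>2 * k)\<close> by Cauchy-Schwarz, and its
  mean is at most \<open>4 / 512 = (1 / 32) / 4\<close> times \<open>q i\<close>, just what the tail
  bound for nonnegative summands asks for at the threshold 1/32.\<close>

lemma net_tail:
  assumes y: "dotp n y y \<le> 4" and sp: "G * (real k / real m + real k * \<epsilon>) \<le> 1 / 512"
  shows "measure (\<Pi>\<^sub>M j\<in>{..<p::nat}. D) {X \<in> space (\<Pi>\<^sub>M j\<in>{..<p}. D).
      real p * q i * (1 / 32) \<le> (\<Sum>j<p. of_bool (X j i \<noteq> 0) * (dotp n y (res (X j)))\<^sup>2)}
    \<le> exp (- (real p * q i / (512 * C\<^sup>2 * real k)))"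
proof -
  let ?f = "\<lambda>x. of_bool (x i \<noteq> 0) * (dotp n y (res x))\<^sup>2"
  define B where "B = 8 * C\<^sup>2 * real k"
  have B: "B > 0" using C_ge_1 k_pos by (simp add: B_def)
  have m: "?f \<in> borel_measurable D" by measurable
  have "measure (\<Pi>\<^sub>M j\<in>{..<p}. D) {X \<in> space (\<Pi>\<^sub>M j\<in>{..<p}. D).
      real p * q i * (1 / 32) \<le> (\<Sum>j<p. ?f (X j))} \<le> exp (- (real p * q i * (1 / 32) / (2 * B)))"
  proof (rule iid_sum_nonneg_tail[OF D.prob_space_axioms m _ B])
    show "AE x in D. 0 \<le> ?f x \<and> ?f x \<le> B"
      using AE_good
    proof eventually_elim
      case (elim x)
      have "(dotp n y (res x))\<^sup>2 \<le> dotp n y y * dotp n (res x) (res x)" by (rule dotp_Cauchy_Schwarz)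
      also have "\<dots> \<le> 4 * (2 * C\<^sup>2 * real k)" using y res_norm[OF elim] by (intro mult_mono) auto
      finally show ?case using B by (auto simp: B_def)
    qed
    have "(\<integral>x. ?f x \<partial>D) \<le> q i * (G * (real k / real m + real k * \<epsilon>)) * dotp n y y"
      by (rule mean_res_sq)
    also have "\<dots> \<le> q i * (1 / 512) * 4"
      using y sp q_pos[OF i] G_nonneg \<epsilon>_pos
      by (intro mult_mono) (auto intro!: mult_nonneg_nonneg add_nonneg_nonneg)
    finally show "(\<integral>x. ?f x \<partial>D) \<le> q i * (1 / 32 / 4)" by simp
  qed
  then show ?thesis by (simp add: B_def mult_ac)
qed

section \<open>From the tail bounds to the recovered column\<close>

lemma sum_over_cluster:
  "(\<Sum>j<p. of_bool (X j i \<noteq> 0) * f j) = (\<Sum>j\<in>correct_clustering m p X i. (f j :: real))"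
proof -
  have "(\<Sum>j<p. of_bool (X j i \<noteq> 0) * f j) = (\<Sum>j\<in>correct_clustering m p X i. of_bool (X j i \<noteq> 0) * f j)"
    by (rule sum.mono_neutral_right) (auto simp: correct_clustering_def supp_def i)
  also have "\<dots> = (\<Sum>j\<in>correct_clustering m p X i. f j)"
    by (rule sum.cong) (auto simp: correct_clustering_def supp_def)
  finally show ?thesis .
qed

text \<open>No probability is left: the hypotheses exclude the tail events, and the perturbation
  lemma is applied with \<open>h = 1 / 4\<close>, gap 1/4 and \<open>g = \<zeta> / 8\<close>, which
  gives \<open>\<zeta> * sqrt 2 / 2\<close>. Bias and fluctuation contribute
  \<open>\<zeta> / 32\<close> each relative to \<open>p * q i\<close>, and
  \<open>p * q i < 2 * N\<close> doubles their sum to \<open>\<zeta> / 8\<close>.\<close>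

lemma column_recovery:
  fixes X :: "nat \<Rightarrow> nat \<Rightarrow> real"
  assumes good: "\<And>j. j < p \<Longrightarrow> good (X j)"
    and size: "(\<Sum>j<p. of_bool (X j i \<noteq> 0)) > real p * q i / 2"
    and coord: "\<And>r. r < n \<Longrightarrow> \<bar>(\<Sum>j<p. of_bool (X j i \<noteq> 0) * (res (X j) r * ov (X j))) - real p * bias r\<bar>
        \<le> real p * q i * (\<zeta> / (32 * sqrt (real n)))"
    and net: "\<And>w. dotp n w w = 1 \<Longrightarrow> \<exists>y\<in>F. dotp n (\<lambda>r. w r - y r) (\<lambda>r. w r - y r) \<le> \<delta>"
    and quad: "\<And>y. y \<in> F \<Longrightarrow> (\<Sum>j<p. of_bool (X j i \<noteq> 0) * (dotp n y (res (X j)))\<^sup>2) \<le> real p * q i * (1 / 32)"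
    and \<delta>: "64 * C\<^sup>2 * real k * \<delta> \<le> 1"
    and bias: "sqrt (dotp n bias bias) \<le> q i * (\<zeta> / 32)" and \<zeta>: "\<zeta> \<ge> 0"
    and top: "top_singular_vector n
      (cluster_covariance (\<lambda>j. mat_vec m A (X j)) (correct_clustering m p X i)) u"
  shows "\<exists>s\<in>{1, -1}. L2_set (\<lambda>r. A r i - s * u r) {..<n} \<le> \<zeta>"
proof -
  note sum_cl = sum_over_cluster[where X = X and p = p]
  define S where "S = correct_clustering m p X i"
  define Q where "Q = cluster_covariance (\<lambda>j. mat_vec m A (X j)) S"
  define N where "N = real (card S)"
  have finS: "finite S" by (simp add: S_def correct_clustering_def)
  have SD: "good (X j)" "X j i \<noteq> 0" if "j \<in> S" for j
    using that good by (auto simp: S_def correct_clustering_def supp_def)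
  have N_eq: "(\<Sum>j<p. of_bool (X j i \<noteq> 0)) = N"
    using sum_cl[where f = "\<lambda>_. 1"] by (simp add: N_def S_def)
  have Npq: "real p * q i < 2 * N" using size N_eq by simp
  have pq0: "real p * q i \<ge> 0" using q_pos[OF i] by simp
  have N0: "N > 0" using Npq pq0 by linarith
  have form: "dotp n v (mat_vec n Q w)
      = (\<Sum>j\<in>S. dotp n v (mat_vec m A (X j)) * dotp n (mat_vec m A (X j)) w) / N" for v w
    unfolding Q_def N_def by (rule cluster_covariance_form)
  \<comment> \<open>Orthogonally to \<open>e\<close> the large component \<open>x i * e\<close>
    disappears, so both remaining blocks involve the residual.\<close>
  have orth: "dotp n w (mat_vec m A x) = dotp n w (res x)" if "dotp n e w = 0" for w x
    unfolding mat_vec_split dotp_linear dotp_commute[of n w e] that by simp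
  have "\<exists>s\<in>{1, -1}. L2_set (\<lambda>r. e r - s * u r) {..<n} \<le> sqrt 2 * ((\<zeta> / 8) / (1 / 4))"
  proof (rule top_singular_vector_perturbation[where h = "1 / 4"])
    show "Q r s = Q s r" for r s unfolding Q_def by (rule cluster_covariance_sym)
    show "0 < n" by (rule n_pos)
    show "0 \<le> dotp n y (mat_vec n Q y)" for y
      unfolding form using N0 by (auto intro!: divide_nonneg_pos sum_nonneg simp: dotp_commute[of n y])
    show "dotp n e e = 1" by (rule e_unit)
    show "top_singular_vector n Q u" using top by (simp add: Q_def S_def)
    show "0 \<le> \<zeta> / 8" using \<zeta> by simp
  next
    fix w assume w: "dotp n e w = 0"
    define V where "V = (\<lambda>r. \<Sum>j\<in>S. res (X j) r * ov (X j))"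
    define V' where "V' = (\<lambda>r. V r - real p * bias r)"
    have V'r: "\<bar>V' r\<bar> \<le> real p * q i * (\<zeta> / (32 * sqrt (real n)))" if "r < n" for r
      using coord[OF that] unfolding sum_cl by (simp add: V'_def V_def S_def)
    have "dotp n V' V' \<le> real n * (real p * q i * (\<zeta> / (32 * sqrt (real n))))\<^sup>2"
    proof -
      have "(V' r)\<^sup>2 \<le> (real p * q i * (\<zeta> / (32 * sqrt (real n))))\<^sup>2" if "r < n" for r
        using power_mono[OF V'r[OF that], of 2] by simp
      then have "(\<Sum>r<n. (V' r)\<^sup>2)
          \<le> real (card {..<n}) * (real p * q i * (\<zeta> / (32 * sqrt (real n))))\<^sup>2"
        by (intro sum_bounded_above) simp
      then show ?thesis by (simp only: dotp_def card_lessThan flip: power2_eq_square)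
    qed
    also have "\<dots> = (real p * q i * (\<zeta> / 32))\<^sup>2"
      using n_pos by (simp add: power_mult_distrib power_divide)
    finally have V'n: "sqrt (dotp n V' V') \<le> real p * q i * (\<zeta> / 32)"
      using pq0 \<zeta> by (intro real_le_lsqrt) auto
    have "dotp n w (mat_vec n Q e) = (\<Sum>j\<in>S. dotp n w (res (X j)) * ov (X j)) / N"
      unfolding form orth[OF w] ov_def ..
    also have "(\<Sum>j\<in>S. dotp n w (res (X j)) * ov (X j)) = dotp n w V"
      unfolding V_def dotp_sum_right mult.commute[of _ "ov _"] dotp_scale_right ..
    also have "dotp n w V = dotp n w V' + real p * dotp n w bias"
      unfolding V'_def dotp_linear by simp
    finally have "\<bar>dotp n w (mat_vec n Q e)\<bar> = \<bar>dotp n w V' + real p * dotp n w bias\<bar> / N"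
      using N0 by simp
    also have "\<dots> \<le> (sqrt (dotp n w w) * (real p * q i * (\<zeta> / 16))) / N"
    proof (rule divide_right_mono)
      have "\<bar>dotp n w V' + real p * dotp n w bias\<bar> \<le> \<bar>dotp n w V'\<bar> + real p * \<bar>dotp n w bias\<bar>"
        using abs_triangle_ineq[of "dotp n w V'" "real p * dotp n w bias"] by (simp add: abs_mult)
      also have "\<dots> \<le> sqrt (dotp n w w) * sqrt (dotp n V' V') + real p * (sqrt (dotp n w w) * sqrt (dotp n bias bias))"
        by (intro add_mono mult_left_mono dotp_abs_le) simp
      also have "\<dots> \<le> sqrt (dotp n w w) * (real p * q i * (\<zeta> / 32)) + real p * (sqrt (dotp n w w) * (q i * (\<zeta> / 32)))"
        using V'n bias by (intro add_mono mult_left_mono) auto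
      also have "\<dots> = sqrt (dotp n w w) * (real p * q i * (\<zeta> / 16))" by (simp add: field_simps)
      finally show "\<bar>dotp n w V' + real p * dotp n w bias\<bar> \<le> sqrt (dotp n w w) * (real p * q i * (\<zeta> / 16))" .
    qed (use N0 in simp)
    also have "\<dots> \<le> (sqrt (dotp n w w) * (2 * N * (\<zeta> / 16))) / N"
      using Npq N0 \<zeta> by (intro divide_right_mono mult_left_mono mult_right_mono) auto
    also have "\<dots> = \<zeta> / 8 * sqrt (dotp n w w)" using N0 by simp
    finally show "\<bar>dotp n w (mat_vec n Q e)\<bar> \<le> \<zeta> / 8 * sqrt (dotp n w w)" .
  next
    fix w assume w: "dotp n e w = 0"
    have *: "dotp n w (mat_vec n Q w) = (\<Sum>j\<in>S. (dotp n w (res (X j)))\<^sup>2) / N" if "dotp n e w = 0" for w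
      unfolding form dotp_commute[of n "mat_vec m A _" w] orth[OF that] power2_eq_square ..
    have unit: "dotp n w (mat_vec n Q w) \<le> 1 / 4" if w: "dotp n e w = 0" "dotp n w w = 1" for w
    proof -
      obtain y where y: "y \<in> F" and d: "dotp n (\<lambda>r. w r - y r) (\<lambda>r. w r - y r) \<le> \<delta>"
        using net[OF w(2)] by blast
      have "(\<Sum>j\<in>S. (dotp n w (res (X j)))\<^sup>2)
          \<le> (\<Sum>j\<in>S. 2 * (dotp n y (res (X j)))\<^sup>2 + 1 / 16)"
      proof (rule sum_mono)
        fix j assume j: "j \<in> S"
        let ?v = "dotp n (\<lambda>r. w r - y r) (res (X j))"
        have "?v\<^sup>2 \<le> dotp n (\<lambda>r. w r - y r) (\<lambda>r. w r - y r) * dotp n (res (X j)) (res (X j))"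
          by (rule dotp_Cauchy_Schwarz)
        also have "\<dots> \<le> \<delta> * (2 * C\<^sup>2 * real k)"
          using d res_norm[OF SD(1)[OF j]] order_trans[OF dotp_self_nonneg d] by (intro mult_mono) auto
        finally have v: "2 * ?v\<^sup>2 \<le> 1 / 16" using \<delta> by (simp add: mult_ac)
        have "dotp n w (res (X j)) = dotp n y (res (X j)) + ?v" by (simp add: dotp_linear)
        then have "(dotp n w (res (X j)))\<^sup>2 \<le> 2 * (dotp n y (res (X j)))\<^sup>2 + 2 * ?v\<^sup>2"
          using zero_le_power2[of "dotp n y (res (X j)) - ?v"] by (simp add: power2_eq_square algebra_simps)
        then show "(dotp n w (res (X j)))\<^sup>2 \<le> 2 * (dotp n y (res (X j)))\<^sup>2 + 1 / 16" using v by linarith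
      qed
      also have "\<dots> = 2 * (\<Sum>j\<in>S. (dotp n y (res (X j)))\<^sup>2) + N / 16"
        by (simp add: sum.distrib sum_distrib_left N_def)
      also have "\<dots> \<le> N / 4"
        using quad[OF y] Npq N0 unfolding sum_cl S_def[symmetric] by linarith
      finally have "(\<Sum>j\<in>S. (dotp n w (res (X j)))\<^sup>2) \<le> N / 4" .
      then show ?thesis unfolding *[OF w(1)] using N0 by (simp add: divide_simps)
    qed
    show "dotp n w (mat_vec n Q w) \<le> 1 / 4 * dotp n w w"
    proof (cases "dotp n w w = 0")
      case True
      then have "dotp n w (mat_vec n Q w) = 0"
        using dotp_self_eq_0D[OF True] by (simp add: dotp_def)
      then show ?thesis using True by simp
    next
      case False
      define d where "d = sqrt (dotp n w w)"
      have d: "d > 0" "d * d = dotp n w w" using False by (auto simp: d_def less_le)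
      let ?w = "\<lambda>r. (1 / d) * w r"
      have "dotp n ?w ?w = 1" unfolding dotp_linear d(2)[symmetric] using d(1) by simp
      moreover have "dotp n e ?w = 0" unfolding dotp_linear w by simp
      ultimately have "dotp n ?w (mat_vec n Q ?w) \<le> 1 / 4" by (intro unit)
      then have "dotp n w (mat_vec n Q w) / (d * d) \<le> 1 / 4"
        unfolding mat_vec_scale dotp_linear by simp
      moreover have "0 < d * d" using d(1) by simp
      ultimately show ?thesis unfolding d(2)[symmetric] by (simp only: pos_divide_le_eq)
    qed
  next
    have "N * (1 / 2) \<le> (\<Sum>j\<in>S. (ov (X j))\<^sup>2)"
      using sum_bounded_below[of S "1 / 2" "\<lambda>j. (ov (X j))\<^sup>2"] ov_sq_ge SD by (simp add: N_def)
    also have "\<dots> = N * dotp n e (mat_vec n Q e)"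
      unfolding form using N0 by (simp add: ov_def dotp_commute[of n e] power2_eq_square)
    finally show "1 / 4 + 1 / 4 \<le> dotp n e (mat_vec n Q e)" using N0 by simp
  qed auto
  moreover have "sqrt 2 * ((\<zeta> / 8) / (1 / 4)) \<le> \<zeta>"
  proof -
    have "sqrt 2 \<le> 2" by (rule real_le_lsqrt) auto
    then have "sqrt 2 * \<zeta> \<le> 2 * \<zeta>" using \<zeta> by (rule mult_right_mono)
    then show ?thesis by simp
  qed
  ultimately show ?thesis by (force simp: e_def col_def)
qed

text \<open>A union bound over one size event, \<open>2 * n\<close> coordinate events and the grid
  events. The conclusion covers every top singular vector \<open>u\<close>, so the exceptional set
  is given as a measurable \<open>Bad\<close> that contains the failures.\<close>

lemma column_recovery_failure:
  fixes p :: nat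
  defines "P \<equiv> \<Pi>\<^sub>M j\<in>{..<p}. D"
  assumes bs: "G\<^sup>2 * (1 / real m + \<epsilon>) \<le> 1 / 1024"
    and sp: "G * (real k / real m + real k * \<epsilon>) \<le> 1 / 512"
    and z: "real k * \<epsilon> \<le> \<zeta>" "\<zeta> \<le> 1"
    and n3: "n \<ge> 3" and kn: "k \<le> n" and Cn: "8 * C \<le> real n"
    and rate: "exp (- (real p * q i / 16))
       + 2 * real n * exp (- (real p * q i * (\<zeta> / (32 * sqrt (real n)))\<^sup>2 / (36 * C ^ 4 * real k)))
       + real n ^ (3 * n) * exp (- (real p * q i / (512 * C\<^sup>2 * real k))) \<le> W"
  shows "\<exists>Bad\<in>sets P. measure P Bad \<le> W \<and>
     (\<forall>X\<in>space P - Bad. (\<forall>j<p. good (X j)) \<longrightarrow> (\<forall>u. top_singular_vector n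
        (cluster_covariance (\<lambda>j. mat_vec m A (X j)) (correct_clustering m p X i)) u \<longrightarrow>
        (\<exists>s\<in>{1, -1}. L2_set (\<lambda>r. A r i - s * u r) {..<n} \<le> \<zeta>)))"
proof -
  interpret PP: product_prob_space "\<lambda>_::nat. D" "{..<p}" by standard
  interpret P: prob_space P unfolding P_def by (rule PP.P.prob_space_axioms)
  have z0: "\<zeta> \<ge> 0" using z \<epsilon>_pos by (smt (verit) of_nat_0_le_iff mult_nonneg_nonneg)
  \<comment> \<open>Mesh \<open>1 / n\<^sup>2\<close> makes the squared distance to the grid at most
    \<open>n\<close> to the power -3, enough against \<open>64 * C\<^sup>2 * k\<close> when
    \<open>k \<le> n\<close> and \<open>8 * C \<le> n\<close>, while
    \<open>2 * n\<^sup>2 + 1 \<le> n ^ 3\<close> keeps the grid within \<open>n ^ (3 * n)\<close>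
    points.\<close>
  have "n \<le> (n\<^sup>2)\<^sup>2" using n3 by (simp flip: power_mult add: self_le_power)
  then obtain F :: "(nat \<Rightarrow> real) set" where F: "finite F" "card F \<le> (2 * n\<^sup>2 + 1) ^ n"
    "\<And>y. y \<in> F \<Longrightarrow> dotp n y y \<le> 4"
    "\<And>w. dotp n w w = 1 \<Longrightarrow> \<exists>y\<in>F. dotp n (\<lambda>r. w r - y r) (\<lambda>r. w r - y r) \<le> real n / (real (n\<^sup>2))\<^sup>2"
    using unit_vector_net[of "n\<^sup>2" n] n3 by (auto simp: Suc_le_eq)
  define \<tau> where "\<tau> = \<zeta> / (32 * sqrt (real n))"
  have \<tau>: "0 \<le> \<tau>" "\<tau> \<le> 1"
  proof -
    have "sqrt (real n) \<ge> 1" using n3 by simp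
    then have "\<zeta> \<le> 32 * sqrt (real n)" "0 < 32 * sqrt (real n)" using z by linarith+
    then show "0 \<le> \<tau>" "\<tau> \<le> 1" using z0 by (auto simp: \<tau>_def)
  qed
  define B1 where "B1 = {X \<in> space P. (\<Sum>j<p. of_bool (X j i \<noteq> 0)) \<le> real p * q i / 2}"
  define B2 where "B2 = (\<lambda>s r. {X \<in> space P. real p * (s * bias r) + real p * q i * \<tau>
        \<le> (\<Sum>j<p. s * (of_bool (X j i \<noteq> 0) * (res (X j) r * ov (X j))))})"
  define B3 where "B3 = (\<lambda>y. {X \<in> space P. real p * q i * (1 / 32)
        \<le> (\<Sum>j<p. of_bool (X j i \<noteq> 0) * (dotp n y (res (X j)))\<^sup>2)})"
  have pull: "(\<lambda>X. \<Sum>j<p. f (X j)) \<in> borel_measurable P"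
    if "f \<in> borel_measurable D" for f :: "_ \<Rightarrow> real"
    unfolding P_def using that by measurable
  have mB1: "B1 \<in> sets P"
    unfolding B1_def using pull[OF measurable_in_cluster] by measurable
  have mB2: "B2 s r \<in> sets P" for s r
  proof -
    have "(\<lambda>x. s * (of_bool (x i \<noteq> 0) * (res x r * ov x))) \<in> borel_measurable D" by measurable
    then show ?thesis unfolding B2_def using pull by measurable
  qed
  have mB3: "B3 y \<in> sets P" for y
  proof -
    have "(\<lambda>x. of_bool (x i \<noteq> 0) * (dotp n y (res x))\<^sup>2) \<in> borel_measurable D" by measurable
    then show ?thesis unfolding B3_def using pull by measurable
  qed
  let ?e2 = "exp (- (real p * q i * \<tau>\<^sup>2 / (36 * C ^ 4 * real k)))"
  let ?e3 = "exp (- (real p * q i / (512 * C\<^sup>2 * real k)))"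
  have p1: "measure P B1 \<le> exp (- (real p * q i / 16))"
    unfolding B1_def P_def by (rule cluster_size_tail)
  have p2: "measure P (B2 s r) \<le> ?e2" if "s \<in> {1, -1}" "r < n" for s r
    unfolding B2_def P_def using coordinate_tail[OF that \<tau>] .
  have p3: "measure P (B3 y) \<le> ?e3" if "y \<in> F" for y
    unfolding B3_def P_def using net_tail[OF F(3)[OF that] sp] .
  define U2 where "U2 = (\<Union>s\<in>{1, -1}. \<Union>r<n. B2 s r)"
  define U3 where "U3 = (\<Union>y\<in>F. B3 y)"
  have mU: "U2 \<in> sets P" "U3 \<in> sets P"
    unfolding U2_def U3_def using mB2 mB3 F(1) by (auto intro!: sets.finite_UN)
  have q2: "measure P (\<Union>r<n. B2 s r) \<le> real n * ?e2" if "s \<in> {1, -1}" for s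
  proof -
    have "measure P (\<Union>r<n. B2 s r) \<le> (\<Sum>r<n. measure P (B2 s r))"
      using mB2 by (intro P.finite_measure_subadditive_finite) auto
    also have "\<dots> \<le> (\<Sum>r<n. ?e2)" using p2[OF that] by (intro sum_mono) auto
    finally show ?thesis by simp
  qed
  have u2: "measure P U2 \<le> 2 * real n * ?e2"
  proof -
    have "U2 = (\<Union>r<n. B2 1 r) \<union> (\<Union>r<n. B2 (-1) r)" by (auto simp: U2_def)
    then have "measure P U2 \<le> measure P (\<Union>r<n. B2 1 r) + measure P (\<Union>r<n. B2 (-1) r)"
      using mB2 measure_Un_le[of "\<Union>r<n. B2 1 r" P "\<Union>r<n. B2 (-1) r"] by (auto intro!: sets.finite_UN)
    then show ?thesis using q2[of 1] q2[of "-1"] by simp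
  qed
  have u3: "measure P U3 \<le> real n ^ (3 * n) * ?e3"
  proof -
    have "measure P U3 \<le> (\<Sum>y\<in>F. measure P (B3 y))"
      unfolding U3_def using mB3 F(1) by (intro P.finite_measure_subadditive_finite) auto
    also have "\<dots> \<le> (\<Sum>y\<in>F. ?e3)" using p3 by (intro sum_mono) auto
    also have "\<dots> = real (card F) * ?e3" by simp
    also have "\<dots> \<le> real (n ^ (3 * n)) * ?e3"
    proof (intro mult_right_mono of_nat_mono)
      have "2 * n\<^sup>2 + 1 \<le> 3 * n\<^sup>2" using n3 by (simp add: Suc_le_eq)
      also have "\<dots> \<le> n ^ 3" using n3 by (simp add: power2_eq_square power3_eq_cube)
      finally have "(2 * n\<^sup>2 + 1) ^ n \<le> (n ^ 3) ^ n" by (rule power_mono) simp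
      then show "card F \<le> n ^ (3 * n)" using F(2) by (simp add: power_mult)
    qed simp
    finally show ?thesis by simp
  qed
  define Bad where "Bad = B1 \<union> (U2 \<union> U3)"
  have mBad: "Bad \<in> sets P" using mB1 mU by (simp add: Bad_def)
  have "measure P Bad \<le> measure P B1 + (measure P U2 + measure P U3)"
    unfolding Bad_def using measure_Un_le[OF mB1, of "U2 \<union> U3"] measure_Un_le[OF mU] mU by force
  then have mes: "measure P Bad \<le> W"
    using p1 u2 u3 rate unfolding \<tau>_def by linarith
  have \<delta>: "64 * C\<^sup>2 * real k * (real n / (real (n\<^sup>2))\<^sup>2) \<le> 1"
  proof -
    have "(8 * C)\<^sup>2 \<le> (real n)\<^sup>2" using Cn C_ge_1 by (intro power_mono) auto
    then have "64 * C\<^sup>2 * real k \<le> (real n)\<^sup>2 * real n"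
      using kn by (intro mult_mono) (auto simp: power_mult_distrib)
    then have "64 * C\<^sup>2 * real k * real n \<le> (real n)\<^sup>2 * real n * real n" by (rule mult_right_mono) simp
    also have "\<dots> = (real (n\<^sup>2))\<^sup>2" by (simp add: power2_eq_square)
    finally show ?thesis using n3 by (simp add: divide_le_eq)
  qed
  have "\<exists>s\<in>{1, -1}. L2_set (\<lambda>r. A r i - s * u r) {..<n} \<le> \<zeta>"
    if X: "X \<in> space P - Bad" and g: "\<forall>j<p. good (X j)"
      and top: "top_singular_vector n (cluster_covariance (\<lambda>j. mat_vec m A (X j)) (correct_clustering m p X i)) u"
    for X u
  proof (rule column_recovery[OF _ _ _ F(4) _ \<delta> bias_norm[OF bs z(1)] z0 top])
    show "good (X j)" if "j < p" for j using g that by blast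
    show "real p * q i / 2 < (\<Sum>j<p. of_bool (X j i \<noteq> 0))"
      using X by (auto simp: Bad_def B1_def)
    show "(\<Sum>j<p. of_bool (X j i \<noteq> 0) * (dotp n y (res (X j)))\<^sup>2) \<le> real p * q i * (1 / 32)"
      if "y \<in> F" for y
    proof -
      have "X \<notin> B3 y" using X that by (auto simp: Bad_def U3_def)
      then show ?thesis using X unfolding B3_def by (simp add: not_le del: sum_mult_of_bool_eq sum_of_bool_mult_eq)
    qed
    fix r assume r: "r < n"
    define s where "s = (\<Sum>j<p. of_bool (X j i \<noteq> 0) * (res (X j) r * ov (X j)))"
    have "X \<notin> B2 1 r" "X \<notin> B2 (-1) r" using X r by (auto simp: Bad_def U2_def)
    then have "\<not> real p * (1 * bias r) + real p * q i * \<tau> \<le> 1 * s"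
      "\<not> real p * ((-1) * bias r) + real p * q i * \<tau> \<le> (-1) * s"
      using X unfolding B2_def s_def sum_distrib_left by blast+
    then show "\<bar>(\<Sum>j<p. of_bool (X j i \<noteq> 0) * (res (X j) r * ov (X j))) - real p * bias r\<bar>
        \<le> real p * q i * (\<zeta> / (32 * sqrt (real n)))"
      unfolding s_def[symmetric] \<tau>_def[symmetric] by (simp add: abs_le_iff)
  qed
  then show ?thesis using mBad mes by blast
qed

end

section \<open>Choice of constants\<close>

text \<open>With \<open>Lam\<close> the product of the logarithms, the first two exponents are at
  least \<open>\<eta> * Lam\<close> and the third \<open>n\<close> times that, which beats the grid
  size. The constant in \<eta> is \<open>36 * 32\<^sup>2\<close>, set by the coordinate tail. The
  three terms take a quarter, a half and a quarter of the allowance.\<close>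

lemma failure_rate_bound:
  fixes n m k :: nat and \<eta> a C \<Delta> \<zeta> pq :: real
  assumes C: "C \<ge> 1" and a: "a > 0" and \<Delta>: "\<Delta> > 0" and \<eta>: "\<eta> = a / (36864 * C ^ 4)"
    and k: "k \<ge> 1" and n: "n \<ge> 3" and m: "m \<ge> 1" and \<zeta>: "0 < \<zeta>" "\<zeta> \<le> 1"
    and Lm: "\<eta> * ln (real m) \<ge> 2 * (\<Delta> + 6)" and Ln: "\<eta> * ln (real n) \<ge> 2"
    and pq: "pq \<ge> a * real k * real n * (ln (real m) * ln (real n)) / \<zeta>\<^sup>2"
  shows "exp (- (pq / 16))
       + 2 * real n * exp (- (pq * (\<zeta> / (32 * sqrt (real n)))\<^sup>2 / (36 * C ^ 4 * real k)))
       + real n ^ (3 * n) * exp (- (pq / (512 * C\<^sup>2 * real k))) \<le> real n powr (- \<Delta>) / real m"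
proof -
  define Lam where "Lam = ln (real m) * ln (real n)"
  have \<eta>0: "\<eta> > 0" using a C by (simp add: \<eta>)
  have lm: "ln (real m) \<ge> 0" and ln: "ln (real n) \<ge> 0" using m n by auto
  have Lam0: "Lam \<ge> 0" using lm ln by (simp add: Lam_def)
  have C4: "C ^ 4 \<ge> 1" and C2: "C\<^sup>2 \<ge> 1" using C by auto
  have C42: "C\<^sup>2 \<le> C ^ 4" using C by (intro power_increasing) auto
  have k1: "real k \<ge> 1" using k by simp
  have n0: "real n > 0" and n1: "real n \<ge> 1" using n by auto
  have \<zeta>2: "0 < \<zeta>\<^sup>2" "\<zeta>\<^sup>2 \<le> 1" using \<zeta> by (auto simp: power_le_one)
  have pq': "pq * \<zeta>\<^sup>2 \<ge> a * real k * real n * Lam"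
    using pq \<zeta>2 unfolding Lam_def[symmetric] by (simp only: pos_divide_le_eq)
  have t0: "a * real k * real n * Lam \<ge> 0" using a Lam0 by simp
  have pq0: "pq \<ge> 0" using pq' t0 \<zeta>2 by (smt (verit) mult_neg_pos)
  have pq'': "pq \<ge> a * real k * real n * Lam"
    using pq' mult_left_mono[OF \<zeta>2(2) pq0] by simp
  have E2: "pq * (\<zeta> / (32 * sqrt (real n)))\<^sup>2 / (36 * C ^ 4 * real k) \<ge> \<eta> * Lam"
  proof -
    have "pq * (\<zeta> / (32 * sqrt (real n)))\<^sup>2 / (36 * C ^ 4 * real k)
        = (pq * \<zeta>\<^sup>2) / (36864 * C ^ 4 * real k * real n)"
      using n0 by (simp add: power_divide power_mult_distrib mult_ac)
    also have "\<dots> \<ge> (a * real k * real n * Lam) / (36864 * C ^ 4 * real k * real n)"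
      using pq' C4 by (intro divide_right_mono) auto
    also have "(a * real k * real n * Lam) / (36864 * C ^ 4 * real k * real n) = \<eta> * Lam"
      using n0 k1 by (simp add: \<eta>)
    finally show ?thesis .
  qed
  have E3: "pq / (512 * C\<^sup>2 * real k) \<ge> real n * (\<eta> * Lam)"
  proof -
    have "real n * (\<eta> * Lam) = (a * real n * Lam) / (36864 * C ^ 4)" by (simp add: \<eta>)
    also have "\<dots> \<le> (a * real n * Lam) / (512 * C\<^sup>2)"
      using a Lam0 C2 C42 by (intro divide_left_mono) auto
    also have "\<dots> = (a * real k * real n * Lam) / (512 * C\<^sup>2 * real k)" using k1 by simp
    also have "\<dots> \<le> pq / (512 * C\<^sup>2 * real k)" using pq'' by (intro divide_right_mono) auto
    finally show ?thesis .
  qed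
  have E1: "pq / 16 \<ge> \<eta> * Lam"
  proof -
    have "\<eta> * Lam \<le> (a / 16) * Lam"
      using a C4 Lam0 unfolding \<eta> by (intro mult_right_mono divide_left_mono) auto
    also have "\<dots> \<le> (a * real k * real n * Lam) / 16"
    proof -
      have "1 * 1 \<le> real k * real n" using k1 n1 by (intro mult_mono) auto
      then have "(a * Lam) * 1 \<le> (a * Lam) * (real k * real n)"
        using a Lam0 by (intro mult_left_mono) auto
      then show ?thesis by (simp add: mult_ac)
    qed
    also have "\<dots> \<le> pq / 16" using pq'' by simp
    finally show ?thesis .
  qed
  \<comment> \<open>The allowance for one column; the division by \<open>m\<close> pays for the
    union over all columns.\<close>
  define W where "W = real n powr (- \<Delta>) / real m"
  have W: "W = exp (- \<Delta> * ln (real n) - ln (real m))"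
    using m n0 by (simp add: W_def powr_def exp_diff exp_minus)
  have W0: "W > 0" by (simp add: W)
  \<comment> \<open>The average of two lower bounds for \<open>\<eta> * Lam\<close>, one from each
    large logarithm. The 6 is made of 3 for the grid exponent and 3 for the numerical
    factors.\<close>
  have H: "\<eta> * Lam \<ge> (\<Delta> + 6) * ln (real n) + ln (real m)"
    using mult_right_mono[OF Lm ln] mult_right_mono[OF Ln lm]
    by (simp add: Lam_def algebra_simps)
  have pow: "exp (- (real j * ln (real n))) = 1 / real n ^ j" for j
    using n0 by (simp add: exp_minus exp_of_nat_mult inverse_eq_divide)
  have h1: "exp (- (\<eta> * Lam)) \<le> W / real n ^ 6"
  proof -
    have "exp (- (\<eta> * Lam)) \<le> exp (- \<Delta> * ln (real n) - ln (real m) + - (real 6 * ln (real n)))"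
      using H by (simp add: algebra_simps)
    also have "\<dots> = W * exp (- (real 6 * ln (real n)))" unfolding exp_add W ..
    finally show ?thesis unfolding pow by simp
  qed
  have n6: "4 * real n \<le> real n ^ 6"
  proof -
    have "(4::real) \<le> 3 ^ 5" by simp
    also have "\<dots> \<le> real n ^ 5" using n by (intro power_mono) auto
    finally have "4 * real n \<le> real n ^ 5 * real n" by (intro mult_right_mono) auto
    then show ?thesis by (simp add: power_numeral_reduce mult_ac)
  qed
  have h2: "exp (- (\<eta> * Lam)) \<le> W / (4 * real n)"
    using h1 n6 W0 n0 by (smt (verit) divide_left_mono mult_pos_pos zero_less_power)
  have A1: "exp (- (pq / 16)) \<le> W / 4"
  proof -
    have "exp (- (pq / 16)) \<le> exp (- (\<eta> * Lam))" using E1 by simp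
    also have "\<dots> \<le> W / (4 * real n)" by (rule h2)
    also have "\<dots> \<le> W / 4" using W0 n1 by (intro divide_left_mono) auto
    finally show ?thesis .
  qed
  have A2: "2 * real n * exp (- (pq * (\<zeta> / (32 * sqrt (real n)))\<^sup>2 / (36 * C ^ 4 * real k))) \<le> W / 2"
  proof -
    have "2 * real n * exp (- (pq * (\<zeta> / (32 * sqrt (real n)))\<^sup>2 / (36 * C ^ 4 * real k)))
        \<le> 2 * real n * (W / (4 * real n))"
    proof (rule mult_left_mono)
      have "exp (- (pq * (\<zeta> / (32 * sqrt (real n)))\<^sup>2 / (36 * C ^ 4 * real k))) \<le> exp (- (\<eta> * Lam))"
        using E2 by simp
      then show "exp (- (pq * (\<zeta> / (32 * sqrt (real n)))\<^sup>2 / (36 * C ^ 4 * real k))) \<le> W / (4 * real n)"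
        using h2 by linarith
    qed simp
    then show ?thesis using n0 by simp
  qed
  have A3: "real n ^ (3 * n) * exp (- (pq / (512 * C\<^sup>2 * real k))) \<le> W / 4"
  proof -
    have "real n * (\<eta> * Lam) \<ge> real n * ((\<Delta> + 6) * ln (real n) + ln (real m))"
      using H by (intro mult_left_mono) auto
    moreover have "real n * ((\<Delta> + 6) * ln (real n) + ln (real m))
        \<ge> \<Delta> * ln (real n) + ln (real m) + real (3 * n + 3) * ln (real n)"
    proof -
      \<comment> \<open>This product is exactly the difference of the two sides of the goal.\<close>
      have "(real n - 1) * ((\<Delta> + 3) * ln (real n) + ln (real m)) \<ge> 0"
        using n1 \<Delta> lm ln by (intro mult_nonneg_nonneg add_nonneg_nonneg) auto
      then show ?thesis by (simp add: algebra_simps)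
    qed
    ultimately have "pq / (512 * C\<^sup>2 * real k) \<ge> \<Delta> * ln (real n) + ln (real m) + real (3 * n + 3) * ln (real n)"
      using E3 by linarith
    then have "exp (- (pq / (512 * C\<^sup>2 * real k)))
        \<le> exp (- \<Delta> * ln (real n) - ln (real m) + - (real (3 * n + 3) * ln (real n)))"
      by (intro exp_le_cancel_iff[THEN iffD2]) simp
    also have "\<dots> = W * exp (- (real (3 * n + 3) * ln (real n)))" unfolding exp_add W ..
    also have "\<dots> = W / real n ^ (3 * n + 3)" unfolding pow by simp
    finally have "real n ^ (3 * n) * exp (- (pq / (512 * C\<^sup>2 * real k)))
        \<le> real n ^ (3 * n) * (W / real n ^ (3 * n + 3))"
      by (rule mult_left_mono) simp
    also have "\<dots> = W / real n ^ 3" using n0 by (simp add: power_add)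
    also have "\<dots> \<le> W / 4"
    proof (rule divide_left_mono)
      have "(4::real) \<le> 3 ^ 3" by simp
      also have "\<dots> \<le> real n ^ 3" using n by (intro power_mono) auto
      finally show "4 \<le> real n ^ 3" .
    qed (use W0 n0 in auto)
    finally show ?thesis .
  qed
  show ?thesis using A1 A2 A3 unfolding W_def[symmetric] by linarith
qed

theorem theorem4p9:
  fixes C a b \<kappa> \<Delta> :: real
  assumes "C \<ge> 1" and "a > 0" and "b > 0" and "\<kappa> > 0" and "\<Delta> > 0"
  shows "\<exists>c>0. \<forall>(n::nat) (m::nat) (k::nat) (p::nat) (\<mu>::real)
           (A :: nat \<Rightarrow> nat \<Rightarrow> real) (D :: (nat \<Rightarrow> real) measure).
           n \<ge> 2 \<longrightarrow> k \<ge> 1 \<longrightarrow> \<mu> > 0 \<longrightarrow>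
           incoherent n m \<mu> A \<longrightarrow>
           class_Gamma m k a b C D \<longrightarrow>
           bounded_moments m 2 \<kappa> D \<longrightarrow>
           real k \<le> c * min (sqrt (real m)) (sqrt (real n) / (\<mu> * ln (real n))) \<longrightarrow>
           real p \<ge> max ((real m)\<^sup>2 * ln (real m) / (real k)\<^sup>2)
                        (real m * real n * ln (real m) * ln (real n) / (zeta n m k \<mu>)\<^sup>2) \<longrightarrow>
           holds_with_prob (\<Pi>\<^sub>M j\<in>{..<p}. D) (1 - real n powr (- \<Delta>))
             (\<lambda>X. \<forall>Ahat.
                overlapping_SVD n m (\<lambda>j. mat_vec m A (X j)) (correct_clustering m p X) Ahat \<longrightarrow>
                (\<forall>i<m. \<exists>s\<in>{1, -1}.
                   L2_set (\<lambda>r. A r i - s * Ahat r i) {..<n} \<le> zeta n m k \<mu>))"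
proof -
  define \<eta> where "\<eta> = a / (36864 * C ^ 4)"
  define G0 where "G0 = C\<^sup>2 * \<kappa>\<^sup>2 * b"
  \<comment> \<open>The entries serve, in order, \<open>small\<close>, the bias, the quadratic form,
    and the size of the logarithms. In the middle two, \<open>3 * c\<close> bounds
    \<open>c\<^sup>2 + 2 * c\<close>, and the added 1 keeps the denominators positive. The last
    entry gives \<open>c\<^sup>2 * (9 * M) \<le> 1\<close>.\<close>
  define c where "c = Min {1 / (8 * C), 1 / (3072 * (G0\<^sup>2 + 1)), 1 / (1536 * (G0 + 1)), exp (- ((\<Delta> + 6) / \<eta>)) / 3}"
  have \<eta>0: "\<eta> > 0" using assms by (simp add: \<eta>_def)
  have G0: "G0 \<ge> 0" using assms by (simp add: G0_def)
  have c_pos: "c > 0"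
    using assms G0 by (auto simp: c_def add_nonneg_pos)
  have c1: "c \<le> 1 / (8 * C)" and c2: "c \<le> 1 / (3072 * (G0\<^sup>2 + 1))"
    and c3: "c \<le> 1 / (1536 * (G0 + 1))" and c4: "c \<le> exp (- ((\<Delta> + 6) / \<eta>)) / 3"
    by (simp_all add: c_def)
  have c1': "8 * (c * C) \<le> 1" using c1 assms(1) by (simp add: field_simps)
  have c8: "8 * c \<le> 1"
  proof -
    have "c * 1 \<le> c * C" using assms(1) c_pos by (intro mult_left_mono) auto
    then show ?thesis using c1' by linarith
  qed
  have G2: "G0\<^sup>2 * (3 * c) \<le> 1 / 1024"
  proof -
    have "c * (3072 * (G0\<^sup>2 + 1)) \<le> 1"
      using c2 by (subst (asm) pos_le_divide_eq) (auto simp: add_nonneg_pos)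
    then show ?thesis using c_pos by (simp add: algebra_simps)
  qed
  have G1: "G0 * (3 * c) \<le> 1 / 512"
  proof -
    have "c * (1536 * (G0 + 1)) \<le> 1"
      using c3 G0 by (subst (asm) pos_le_divide_eq) auto
    then show ?thesis using c_pos by (simp add: algebra_simps)
  qed
  define M where "M = exp (2 * (\<Delta> + 6) / \<eta>)"
  have M0: "M > 0" by (simp add: M_def)
  have cM: "5 * c\<^sup>2 * M \<le> 1"
  proof -
    have "c\<^sup>2 \<le> (exp (- ((\<Delta> + 6) / \<eta>)) / 3)\<^sup>2" using c4 c_pos by (intro power_mono) auto
    also have "\<dots> = exp (- (2 * (\<Delta> + 6) / \<eta>)) / 9"
      by (simp add: power_divide flip: exp_double)
    also have "\<dots> = 1 / (9 * M)" by (simp add: M_def exp_minus inverse_eq_divide)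
    finally have "c\<^sup>2 * (9 * M) \<le> 1" using M0 by (simp add: pos_le_divide_eq)
    moreover have "c\<^sup>2 * M \<ge> 0" using M0 by simp
    ultimately show ?thesis by (simp only: mult_ac)
  qed
  show ?thesis
  proof (intro exI[of _ c] conjI c_pos allI impI)
    fix n m k p :: nat and \<mu> :: real and A :: "nat \<Rightarrow> nat \<Rightarrow> real" and D :: "(nat \<Rightarrow> real) measure"
    assume n2: "n \<ge> 2" and k1: "k \<ge> 1" and \<mu>: "\<mu> > 0" and inc: "incoherent n m \<mu> A"
      and \<Gamma>: "class_Gamma m k a b C D" and mom: "bounded_moments m 2 \<kappa> D"
      and kc: "real k \<le> c * min (sqrt (real m)) (sqrt (real n) / (\<mu> * ln (real n)))"
      and pge: "real p \<ge> max ((real m)\<^sup>2 * ln (real m) / (real k)\<^sup>2)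
                        (real m * real n * ln (real m) * ln (real n) / (zeta n m k \<mu>)\<^sup>2)"
    define \<epsilon>0 where "\<epsilon>0 = \<mu> / sqrt (real n)"
    define z where "z = zeta n m k \<mu>"
    have n0: "real n > 0" using n2 by simp
    have \<epsilon>0: "\<epsilon>0 > 0" using \<mu> n0 by (simp add: \<epsilon>0_def)
    have k1': "real k \<ge> 1" using k1 by simp
    have "ln 2 \<le> ln (real n)" using n2 by simp
    then have lnn: "ln (real n) \<ge> 1 / 2" using ln2_ge_two_thirds by linarith
    have km: "real k \<le> c * sqrt (real m)"
      using kc mult_left_mono[OF min.cobounded1, of c] c_pos by (smt (verit))
    have m0: "m > 0" using km k1' by (cases "m = 0") auto
    then have m0': "real m > 0" by simp
    have km2: "(real k)\<^sup>2 \<le> c\<^sup>2 * real m"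
      using power_mono[OF km, of 2] by (simp add: power_mult_distrib)
    have km2': "(real k)\<^sup>2 / real m \<le> c\<^sup>2" using km2 m0' by (simp add: pos_divide_le_eq)
    have kk: "real k \<le> (real k)\<^sup>2" "1 \<le> (real k)\<^sup>2" using k1' by (auto intro: self_le_power one_le_power)
    have kmc: "real k / real m \<le> c\<^sup>2"
      using km2' kk m0' divide_right_mono[of "real k" "(real k)\<^sup>2" "real m"] by linarith
    \<comment> \<open>Since \<open>k\<close> is at least 1, the sparsity condition is also a lower
      bound on \<open>m\<close> and, in \<open>e2c\<close>, an upper bound on the incoherence
      itself.\<close>
    have m1c: "1 / real m \<le> c\<^sup>2"
      using km2' kk m0' divide_right_mono[of 1 "(real k)\<^sup>2" "real m"] by linarith
    have ke: "real k * \<epsilon>0 \<le> 2 * c"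
    proof -
      have "real k \<le> c * (sqrt (real n) / (\<mu> * ln (real n)))"
        using kc mult_left_mono[OF min.cobounded2, of c] c_pos by (smt (verit))
      then have "real k * \<epsilon>0 \<le> c * (sqrt (real n) / (\<mu> * ln (real n))) * \<epsilon>0"
        using \<epsilon>0 by (intro mult_right_mono) auto
      also have "\<dots> = c / ln (real n)" using \<mu> n0 by (simp add: \<epsilon>0_def)
      also have "\<dots> \<le> c / (1 / 2)" using lnn c_pos by (intro divide_left_mono) auto
      finally show ?thesis by simp
    qed
    have e2c: "\<epsilon>0 \<le> 2 * c"
    proof -
      have "1 * \<epsilon>0 \<le> real k * \<epsilon>0" using k1' \<epsilon>0 by (intro mult_right_mono) auto
      then show ?thesis using ke by linarith
    qed
    have csq: "c\<^sup>2 \<le> c"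
      using mult_left_mono[of c 1 c] c_pos c8 by (simp add: power2_eq_square)
    have gram: "1 / real n \<le> 1 / real m + \<epsilon>0\<^sup>2"
      using incoherent_dimension_bound[OF inc m0] n2 by (simp add: \<epsilon>0_def power_divide)
    have nbig: "1 / real n \<le> 5 * c\<^sup>2"
      using gram m1c power_mono[OF e2c, of 2] \<epsilon>0 by (simp add: power_mult_distrib)
    have nM: "M \<le> real n"
    proof -
      have "1 \<le> 5 * c\<^sup>2 * real n" using nbig n0 by (simp add: pos_divide_le_eq)
      then have "1 * M \<le> (5 * c\<^sup>2 * real n) * M" using M0 by (intro mult_right_mono) auto
      also have "\<dots> = (5 * c\<^sup>2 * M) * real n" by (simp only: mult_ac)
      also have "\<dots> \<le> 1 * real n" using cM by (intro mult_right_mono) auto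
      finally show ?thesis by simp
    qed
    have mM: "M \<le> real m"
    proof -
      have "1 \<le> c\<^sup>2 * real m" using m1c m0' by (simp add: pos_divide_le_eq)
      then have "1 * M \<le> (c\<^sup>2 * real m) * M" using M0 by (intro mult_right_mono) auto
      also have "\<dots> = (c\<^sup>2 * M) * real m" by (simp only: mult_ac)
      also have "\<dots> \<le> 1 * real m"
      proof (rule mult_right_mono)
        have "0 \<le> c\<^sup>2 * M" using M0 by simp
        then show "c\<^sup>2 * M \<le> 1" using cM by linarith
      qed simp
      finally show ?thesis by simp
    qed
    have Lm: "\<eta> * ln (real m) \<ge> 2 * (\<Delta> + 6)" and Ln': "\<eta> * ln (real n) \<ge> 2 * (\<Delta> + 6)"
    proof -
      have "2 * (\<Delta> + 6) / \<eta> \<le> ln (real m)" "2 * (\<Delta> + 6) / \<eta> \<le> ln (real n)"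
        using mM nM m0' n0 by (auto simp: M_def ln_ge_iff)
      then show "\<eta> * ln (real m) \<ge> 2 * (\<Delta> + 6)" "\<eta> * ln (real n) \<ge> 2 * (\<Delta> + 6)"
        using \<eta>0 by (auto simp: pos_divide_le_eq mult.commute)
    qed
    have Ln: "\<eta> * ln (real n) \<ge> 2" using Ln' assms(5) by simp
    have nC: "8 * C \<le> real n"
    proof -
      have "5 * c\<^sup>2 * (8 * C) = 5 * c * (8 * (c * C))" by (simp add: power2_eq_square)
      also have "\<dots> \<le> 5 * c * 1" using c1' c_pos by (intro mult_left_mono) auto
      also have "\<dots> \<le> 1" using c8 c_pos by simp
      finally have a: "5 * c\<^sup>2 * (8 * C) \<le> 1" .
      have "1 \<le> 5 * c\<^sup>2 * real n" using nbig n0 by (simp add: pos_divide_le_eq)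
      then have "5 * c\<^sup>2 * (8 * C) \<le> 5 * c\<^sup>2 * real n" using a by linarith
      then show ?thesis using c_pos by simp
    qed
    have n3: "n \<ge> 3" using nC assms(1) by linarith
    \<comment> \<open>Multiplying the dimension bound by the square of \<open>k\<close> leaves only
      quantities that the sparsity condition makes small.\<close>
    have kn: "k \<le> n"
    proof -
      have "(real k)\<^sup>2 * (1 / real n) \<le> (real k)\<^sup>2 * (1 / real m + \<epsilon>0\<^sup>2)"
        using gram by (intro mult_left_mono) auto
      also have "\<dots> = (real k)\<^sup>2 / real m + (real k * \<epsilon>0)\<^sup>2"
        by (simp add: distrib_left power_mult_distrib)
      also have "\<dots> \<le> c\<^sup>2 + (2 * c)\<^sup>2"
        using km2' ke \<epsilon>0 by (intro add_mono power_mono) auto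
      also have "\<dots> \<le> 1" using csq c8 by (simp add: power_mult_distrib)
      finally have "(real k)\<^sup>2 \<le> real n" using n0 by (simp add: pos_divide_le_eq)
      then show ?thesis using kk by linarith
    qed
    have z_eq: "z = max (real k * \<epsilon>0) (sqrt (real k / real m))"
      by (simp add: z_def zeta_def \<epsilon>0_def mult.commute)
    have z0: "z > 0" using \<epsilon>0 k1' by (simp add: z_eq less_max_iff_disj)
    have z1: "z \<le> 1"
    proof -
      have "sqrt (real k / real m) \<le> c" using kmc c_pos by (intro real_le_lsqrt) auto
      then show ?thesis unfolding z_eq using ke c8 c_pos by linarith
    qed
    have kz: "real k * \<epsilon>0 \<le> z" by (simp add: z_eq)
    interpret S: sparse_model m k a b C \<kappa> D
      using \<Gamma> mom assms k1 by unfold_locales auto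
    have SG: "S.G = G0" by (simp add: S.G_def G0_def)
    interpret PP: product_prob_space "\<lambda>_::nat. D" "{..<p}" by standard
    define P where "P = (\<Pi>\<^sub>M j\<in>{..<p}. D)"
    interpret P: prob_space P unfolding P_def by (rule PP.P.prob_space_axioms)
    \<comment> \<open>Quantified over all \<open>u\<close>, so that the exceptional sets do not
      depend on which admissible output is chosen.\<close>
    define recovered where "recovered = (\<lambda>i X. \<forall>u. top_singular_vector n
        (cluster_covariance (\<lambda>j. mat_vec m A (X j)) (correct_clustering m p X i)) u \<longrightarrow>
        (\<exists>s\<in>{1, -1}. L2_set (\<lambda>r. A r i - s * u r) {..<n} \<le> z))"
    have "\<exists>Bad\<in>sets P. measure P Bad \<le> real n powr (- \<Delta>) / real m \<and>
       (\<forall>X\<in>space P - Bad. (\<forall>j<p. S.good (X j)) \<longrightarrow> recovered i X)" if i: "i < m" for i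
    proof -
      interpret Cl: cluster_model m k a b C \<kappa> D n \<mu> A i
      proof unfold_locales
        have "C * (real k * \<epsilon>0) \<le> C * (2 * c)" using ke assms by (intro mult_left_mono) auto
        also have "\<dots> \<le> 1 / 4" using c1' by (simp add: mult_ac)
        finally show "C * (real k * (\<mu> / sqrt (real n))) \<le> 1 / 4" by (simp add: \<epsilon>0_def)
      qed (use inc \<mu> i n2 in auto)
      have \<epsilon>: "Cl.\<epsilon> = \<epsilon>0" by (simp add: Cl.\<epsilon>_def \<epsilon>0_def)
      have bs: "S.G\<^sup>2 * (1 / real m + Cl.\<epsilon>) \<le> 1 / 1024"
      proof -
        have "S.G\<^sup>2 * (1 / real m + Cl.\<epsilon>) \<le> G0\<^sup>2 * (3 * c)"
          unfolding \<epsilon> SG using m1c e2c csq by (intro mult_left_mono) auto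
        then show ?thesis using G2 by linarith
      qed
      have sp: "S.G * (real k / real m + real k * Cl.\<epsilon>) \<le> 1 / 512"
      proof -
        have "S.G * (real k / real m + real k * Cl.\<epsilon>) \<le> G0 * (3 * c)"
          unfolding \<epsilon> SG using kmc ke csq G0 by (intro mult_left_mono) auto
        then show ?thesis using G1 by linarith
      qed
      have "real p * S.q i \<ge> a * real k * real n * (ln (real m) * ln (real n)) / z\<^sup>2"
      proof -
        have "real m * real n * ln (real m) * ln (real n) / z\<^sup>2 \<le> real p"
          using pge by (simp add: z_def)
        then have "(real m * real n * ln (real m) * ln (real n) / z\<^sup>2) * (a * (real k / real m)) \<le> real p * S.q i"
          using S.q_ge[OF i] assms by (intro mult_mono) auto
        moreover have "(real m * real n * ln (real m) * ln (real n) / z\<^sup>2) * (a * (real k / real m))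
            = a * real k * real n * (ln (real m) * ln (real n)) / z\<^sup>2"
          using m0' by (simp add: mult_ac)
        ultimately show ?thesis by simp
      qed
      from failure_rate_bound[OF assms(1,2,5) \<eta>_def k1 n3 _ z0 z1 Lm Ln this] m0
      have rate: "exp (- (real p * S.q i / 16))
       + 2 * real n * exp (- (real p * S.q i * (z / (32 * sqrt (real n)))\<^sup>2 / (36 * C ^ 4 * real k)))
       + real n ^ (3 * n) * exp (- (real p * S.q i / (512 * C\<^sup>2 * real k))) \<le> real n powr (- \<Delta>) / real m"
        by simp
      show ?thesis
        using Cl.column_recovery_failure[OF bs sp kz[folded \<epsilon>] z1 n3 kn nC rate]
        unfolding P_def recovered_def .
    qed
    then obtain Bad where Bad: "\<And>i. i < m \<Longrightarrow> Bad i \<in> sets P"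
      "\<And>i. i < m \<Longrightarrow> measure P (Bad i) \<le> real n powr (- \<Delta>) / real m"
      "\<And>i X. i < m \<Longrightarrow> X \<in> space P - Bad i \<Longrightarrow> (\<forall>j<p. S.good (X j)) \<Longrightarrow> recovered i X"
      by metis
    have "AE X in P. S.good (X j)" if "j < p" for j
      unfolding P_def using that by (intro AE_PiM_component S.AE_good S.D.prob_space_axioms) auto
    \<comment> \<open>The finitely many almost sure conditions are enclosed in one measurable null
      set \<open>N\<close>, so that \<open>E\<close> is a measurable witness for the inner
      probability.\<close>
    then have "AE X in P. \<forall>j\<in>{..<p}. S.good (X j)"
      by (intro AE_finite_allI) auto
    then obtain N where N: "{X \<in> space P. \<not> (\<forall>j\<in>{..<p}. S.good (X j))} \<subseteq> N" "emeasure P N = 0" "N \<in> sets P"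
      by (rule AE_E)
    define U where "U = (\<Union>i<m. Bad i)"
    have mU: "U \<in> sets P" unfolding U_def using Bad(1) by (auto intro!: sets.finite_UN)
    have pU: "measure P U \<le> real n powr (- \<Delta>)"
    proof -
      have "measure P U \<le> (\<Sum>i<m. measure P (Bad i))"
        unfolding U_def using Bad(1) by (intro P.finite_measure_subadditive_finite) auto
      also have "\<dots> \<le> (\<Sum>i<m. real n powr (- \<Delta>) / real m)" using Bad(2) by (intro sum_mono) auto
      also have "\<dots> = real n powr (- \<Delta>)" using m0' by simp
      finally show ?thesis .
    qed
    define E where "E = space P - (U \<union> N)"
    have mE: "E \<in> sets P" using mU N by (auto simp: E_def)
    have "measure P (U \<union> N) \<le> measure P U + measure P N" using mU N by (intro measure_Un_le) auto
    then have "measure P (U \<union> N) \<le> real n powr (- \<Delta>)" using pU N(2) by (simp add: measure_def)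
    then have pE: "measure P E \<ge> 1 - real n powr (- \<Delta>)"
      unfolding E_def using P.prob_compl[of "U \<union> N"] mU N by simp
    have "\<forall>Ahat. overlapping_SVD n m (\<lambda>j. mat_vec m A (X j)) (correct_clustering m p X) Ahat \<longrightarrow>
          (\<forall>i<m. \<exists>s\<in>{1, -1}. L2_set (\<lambda>r. A r i - s * Ahat r i) {..<n} \<le> zeta n m k \<mu>)"
      if X: "X \<in> E" for X
    proof (intro allI impI)
      fix Ahat i
      assume "overlapping_SVD n m (\<lambda>j. mat_vec m A (X j)) (correct_clustering m p X) Ahat" and i: "i < m"
      then have "top_singular_vector n
          (cluster_covariance (\<lambda>j. mat_vec m A (X j)) (correct_clustering m p X i)) (\<lambda>r. Ahat r i)"
        by (simp add: overlapping_SVD_def)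
      moreover have "X \<in> space P - Bad i" using X i by (auto simp: E_def U_def)
      moreover have "\<forall>j<p. S.good (X j)" using X N(1) by (auto simp: E_def)
      ultimately show "\<exists>s\<in>{1, -1}. L2_set (\<lambda>r. A r i - s * Ahat r i) {..<n} \<le> zeta n m k \<mu>"
        using Bad(3)[OF i] unfolding z_def recovered_def by blast
    qed
    then show "holds_with_prob (\<Pi>\<^sub>M j\<in>{..<p}. D) (1 - real n powr (- \<Delta>))
             (\<lambda>X. \<forall>Ahat.
                overlapping_SVD n m (\<lambda>j. mat_vec m A (X j)) (correct_clustering m p X) Ahat \<longrightarrow>
                (\<forall>i<m. \<exists>s\<in>{1, -1}.
                   L2_set (\<lambda>r. A r i - s * Ahat r i) {..<n} \<le> zeta n m k \<mu>))"
      unfolding holds_with_prob_def P_def[symmetric] using mE pE by blast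
  qed
qed

end
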